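(* Let $G$ be a finite noncyclic $3$-group which is not isomorphic to $L_r$ for any $r\ge 4$, where \[ L_r=\langle a,b\mid a^{3^{r-1}}=b^3=1,\ bab^{-1}=a^{1+3^{r-2}}\rangle . \] Then $G$ is colourable.
   Context: For a group $G$ and a map $\sigma\colon G\to G$ define $\Delta^{(1)}_\sigma(x)=\sigma(x)x$, $\Delta^{(2)}_\sigma(x)=x^{-1}\sigma(x)$, $\Delta^{(3)}_\sigma(x)=x^{-1}\sigma(x)x$. A bijection $\sigma\colon G\to G$ is a colouring bijection if $\Delta^{(1)}_\sigma,\Delta^{(2)}_\sigma,\Delta^{(3)}_\sigma$ are all bijections of $G$. A group is colourable if it admits a colouring bijection. *)

theory Defs
  imports "HOL-Algebra.Algebra"
begin

text \<open>
  A word over the generators \<^typ>\<open>'g\<close> is a list of letters; the letter \<open>(x, True)\<close> stands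
  for \<open>x\<close> and \<open>(x, False)\<close> for the inverse of \<open>x\<close>.  A relation \<open>u = v\<close> is the pair
  \<open>(u, v)\<close> of words.
\<close>

type_synonym 'g word = "('g \<times> bool) list"

inductive word_eq :: "('g word \<times> 'g word) set \<Rightarrow> 'g word \<Rightarrow> 'g word \<Rightarrow> bool"
  for R :: "('g word \<times> 'g word) set" where
  refl: "word_eq R u u"
| sym: "word_eq R u v \<Longrightarrow> word_eq R v u"
| trans: "word_eq R u v \<Longrightarrow> word_eq R v w \<Longrightarrow> word_eq R u w"
| cancel: "word_eq R (u @ [(x, s), (x, \<not> s)] @ v) (u @ v)"
| relation: "(l, r) \<in> R \<Longrightarrow> word_eq R (u @ l @ v) (u @ r @ v)"

definition word_class :: "('g word \<times> 'g word) set \<Rightarrow> 'g word \<Rightarrow> 'g word set" where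
  "word_class R u = {v. word_eq R u v}"

text \<open>
  The group presented by all of \<^typ>\<open>'g\<close> as generators, subject to the relations \<open>R\<close>: words
  modulo the congruence generated by free cancellation and \<open>R\<close>, with concatenation as product.
\<close>

definition presented_group :: "('g word \<times> 'g word) set \<Rightarrow> 'g word set monoid" where
  "presented_group R =
     \<lparr> carrier = range (word_class R),
       monoid.mult = (\<lambda>A B. {w. \<exists>u\<in>A. \<exists>v\<in>B. word_eq R (u @ v) w}),
       monoid.one = word_class R [] \<rparr>"

lemma word_eq_context: "word_eq R u v \<Longrightarrow> word_eq R (p @ u @ q) (p @ v @ q)"
proof (induction rule: word_eq.induct)
  case (cancel u x s v)
  show ?case using word_eq.cancel[of R "p @ u" x s "v @ q"] by simp
next
  case (relation l r u v)
  then show ?case using word_eq.relation[of l r R "p @ u" "v @ q"] by simp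
qed (blast intro: word_eq.intros)+

lemma word_eq_append:
  assumes "word_eq R u u'" "word_eq R v v'"
  shows "word_eq R (u @ v) (u' @ v')"
  using word_eq_context[OF assms(1), of "[]" v] word_eq_context[OF assms(2), of u' "[]"]
  by (auto intro: word_eq.trans)

lemma word_class_eq_iff: "word_class R u = word_class R v \<longleftrightarrow> word_eq R u v"
  unfolding word_class_def by (auto intro: word_eq.intros)

lemma mult_word_class:
  "word_class R u \<otimes>\<^bsub>presented_group R\<^esub> word_class R v = word_class R (u @ v)"
  unfolding presented_group_def word_class_def
  by (auto intro: word_eq.refl word_eq.trans word_eq_append)

definition inv_word :: "'g word \<Rightarrow> 'g word" where
  "inv_word u = rev (map (\<lambda>(x, s). (x, \<not> s)) u)"

lemma word_eq_inv: "word_eq R (inv_word u @ u) []"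
proof (induction u)
  case (Cons a u)
  obtain x s where "a = (x, s)" by force
  then show ?case
    using word_eq.cancel[of R "inv_word u" x "\<not> s" u] Cons.IH
    by (auto simp: inv_word_def intro: word_eq.trans)
qed (simp add: inv_word_def word_eq.refl)

lemma group_presented_group: "group (presented_group R)"
proof (rule groupI)
  fix A assume "A \<in> carrier (presented_group R)"
  then obtain u where "A = word_class R u" by (auto simp: presented_group_def)
  moreover have "word_class R (inv_word u) \<otimes>\<^bsub>presented_group R\<^esub> word_class R u
      = \<one>\<^bsub>presented_group R\<^esub>"
    by (simp add: mult_word_class word_class_eq_iff word_eq_inv)
       (simp add: presented_group_def word_class_eq_iff word_eq_inv)
  ultimately show "\<exists>B\<in>carrier (presented_group R).
      B \<otimes>\<^bsub>presented_group R\<^esub> A = \<one>\<^bsub>presented_group R\<^esub>"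
    by (auto simp: presented_group_def)
next
  have carr: "carrier (presented_group R) = range (word_class R)"
    and one: "\<one>\<^bsub>presented_group R\<^esub> = word_class R []"
    by (simp_all add: presented_group_def)
  show "A \<otimes>\<^bsub>presented_group R\<^esub> B \<in> carrier (presented_group R)"
    if "A \<in> carrier (presented_group R)" "B \<in> carrier (presented_group R)" for A B
    using that by (auto simp: carr mult_word_class)
  show "\<one>\<^bsub>presented_group R\<^esub> \<in> carrier (presented_group R)"
    by (simp add: carr one)
  show "A \<otimes>\<^bsub>presented_group R\<^esub> B \<otimes>\<^bsub>presented_group R\<^esub> C
      = A \<otimes>\<^bsub>presented_group R\<^esub> (B \<otimes>\<^bsub>presented_group R\<^esub> C)"
    if "A \<in> carrier (presented_group R)" "B \<in> carrier (presented_group R)"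
      "C \<in> carrier (presented_group R)" for A B C
    using that by (auto simp: carr mult_word_class)
  show "\<one>\<^bsub>presented_group R\<^esub> \<otimes>\<^bsub>presented_group R\<^esub> A = A"
    if "A \<in> carrier (presented_group R)" for A
    using that by (auto simp: carr one mult_word_class)
qed

datatype generator = Gen_a | Gen_b

definition gen_pow :: "'g \<Rightarrow> nat \<Rightarrow> 'g word" where
  "gen_pow x n = replicate n (x, True)"

definition L :: "nat \<Rightarrow> generator word set monoid" where
  "L r = presented_group
     {(gen_pow Gen_a (3 ^ (r - 1)), []),
      (gen_pow Gen_b 3, []),
      ([(Gen_b, True), (Gen_a, True), (Gen_b, False)], gen_pow Gen_a (1 + 3 ^ (r - 2)))}"

definition Delta1 :: "('a, 'm) monoid_scheme \<Rightarrow> ('a \<Rightarrow> 'a) \<Rightarrow> 'a \<Rightarrow> 'a" where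
  "Delta1 G \<sigma> x = \<sigma> x \<otimes>\<^bsub>G\<^esub> x"

definition Delta2 :: "('a, 'm) monoid_scheme \<Rightarrow> ('a \<Rightarrow> 'a) \<Rightarrow> 'a \<Rightarrow> 'a" where
  "Delta2 G \<sigma> x = inv\<^bsub>G\<^esub> x \<otimes>\<^bsub>G\<^esub> \<sigma> x"

definition Delta3 :: "('a, 'm) monoid_scheme \<Rightarrow> ('a \<Rightarrow> 'a) \<Rightarrow> 'a \<Rightarrow> 'a" where
  "Delta3 G \<sigma> x = inv\<^bsub>G\<^esub> x \<otimes>\<^bsub>G\<^esub> \<sigma> x \<otimes>\<^bsub>G\<^esub> x"

definition colouring_bijection :: "('a, 'm) monoid_scheme \<Rightarrow> ('a \<Rightarrow> 'a) \<Rightarrow> bool" where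
  "colouring_bijection G \<sigma> \<longleftrightarrow>
     bij_betw \<sigma> (carrier G) (carrier G) \<and>
     bij_betw (Delta1 G \<sigma>) (carrier G) (carrier G) \<and>
     bij_betw (Delta2 G \<sigma>) (carrier G) (carrier G) \<and>
     bij_betw (Delta3 G \<sigma>) (carrier G) (carrier G)"

definition colourable :: "('a, 'm) monoid_scheme \<Rightarrow> bool" where
  "colourable G \<longleftrightarrow> (\<exists>\<sigma>. colouring_bijection G \<sigma>)"

end

theory Submission
  imports Defs
begin

text \<open>
  Let \<open>N\<close> be a noncyclic normal subgroup of a 3-group \<open>G\<close>, generated by a central element \<open>c\<close> of
  order 3 or 9 and an element \<open>u\<close> of order 3 that is central modulo \<open>w\<close>, where \<open>w\<close> generates the
  subgroup of order 3 of \<open>\<langle>c\<rangle>\<close>.  Any colouring of \<open>G/N\<close> lifts to \<open>G\<close>: in each fibre one needs a map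
  \<open>N \<rightarrow> N\<close> that is a colouring twisted by conjugation, and since conjugation acts on \<open>N\<close> through a
  group of order 3 only nine twists occur.

  Every noncyclic 3-group has such an \<open>N\<close> with \<open>c = w\<close>, so induction on the order works unless \<open>G/N\<close>
  is cyclic or some \<open>L\<^sub>r\<close> with \<open>r \<ge> 4\<close>.  If \<open>G/N\<close> is cyclic, then either another such \<open>N\<close> has an
  abelian noncyclic quotient, or \<open>G\<close> has order 27, or \<open>G\<close> is some \<open>L\<^sub>r\<close>, or \<open>G\<close> is the direct product
  of a cyclic group and a group of order 3, which is coloured explicitly.  If \<open>G/N\<close> is \<open>L\<^sub>r\<close> and \<open>a\<close>
  lifts its first generator, then \<open>c = a\<^bsup>3^(r-2)\<^esup>\<close> is central, and a suitable choice of \<open>N\<close> inside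
  \<open>\<langle>N, c\<rangle>\<close>, or \<open>\<langle>N, c\<rangle>\<close> itself, has an abelian noncyclic quotient.
\<close>

section \<open>Lifting colourings along group extensions\<close>

text \<open>The obstacle is that the induction says nothing about quotients that are cyclic or some
  \<open>L r\<close> with r >= 4. An abelian noncyclic quotient is always usable, because these
  \<open>L r\<close> are nonabelian. So in the bad cases N is exchanged for a plane that swallows
  the remaining commutators, and the new quotient is seen to be noncyclic because its exponent is
  smaller than its order. New central elements come from cubes: conjugation acts on N through a
  group of order 3, so cubes centralise N. For G/N = \<open>L r\<close> this makes c commute with N;
  that c also commutes with a lift b of the second generator uses c^9 = 1 and 9 dvd 3^(r-2), which
  is where r >= 4 enters. If c^3 is not 1, cubing a^-1 b a = c b n with n in N puts c^3 into <w>, so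
  that <N, c> = <c, u> with c of order 9: this is the origin of the second kind of plane. The group
  L_3 has order 27 and is coloured by a table.\<close>

lemma (in group) colourableI:
  assumes fin: "finite (carrier G)"
    and \<sigma>: "\<And>x. x \<in> carrier G \<Longrightarrow> \<sigma> x \<in> carrier G"
    and inj: "inj_on \<sigma> (carrier G)" "inj_on (\<lambda>x. \<sigma> x \<otimes> x) (carrier G)"
      "inj_on (\<lambda>x. inv x \<otimes> \<sigma> x) (carrier G)"
      "inj_on (\<lambda>x. inv x \<otimes> \<sigma> x \<otimes> x) (carrier G)"
  shows "colourable G"
proof -
  have bij: "bij_betw f (carrier G) (carrier G)"
    if "\<And>x. x \<in> carrier G \<Longrightarrow> f x \<in> carrier G" "inj_on f (carrier G)" for f
    using endo_inj_surj[OF fin _ that(2)] that by (auto simp: bij_betw_def)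
  show ?thesis
    unfolding colourable_def colouring_bijection_def Delta1_def Delta2_def Delta3_def
    using \<sigma> inj by (intro exI[of _ \<sigma>] conjI bij) auto
qed

lemma (in group) colourable_if_trivial:
  assumes "carrier G = {\<one>}"
  shows "colourable G"
  using assms by (intro colourableI[where \<sigma> = "\<lambda>_. \<one>"]) (auto simp: inj_on_def)

text \<open>Moves the problem to explicit labels. The equation \<open>mul x (D x) = S x\<close>
  makes \<open>D\<close> the label of x^-1 sigma(x), so inverses never have to be computed on
  labels, and \<open>mul (D x) x\<close> is then the label of the third difference.\<close>

lemma (in group) colourable_by_labels:
  assumes fin: "finite A" and E: "bij_betw E A (carrier G)"
    and mul: "\<And>x y. x \<in> A \<Longrightarrow> y \<in> A \<Longrightarrow> E x \<otimes> E y = E (mul x y)"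
    and S: "\<And>x. x \<in> A \<Longrightarrow> S x \<in> A" "inj_on S A"
    and D: "\<And>x. x \<in> A \<Longrightarrow> D x \<in> A" "\<And>x. x \<in> A \<Longrightarrow> mul x (D x) = S x" "inj_on D A"
    and inj1: "inj_on (\<lambda>x. mul (S x) x) A" and inj3: "inj_on (\<lambda>x. mul (D x) x) A"
    and mul_closed: "\<And>x y. x \<in> A \<Longrightarrow> y \<in> A \<Longrightarrow> mul x y \<in> A"
  shows "colourable G"
proof (rule colourableI)
  define P where "P = inv_into A E"
  define \<sigma> where "\<sigma> x = E (S (P x))" for x
  have EA: "E a \<in> carrier G" if "a \<in> A" for a using E that by (auto simp: bij_betw_def)
  have carr: "carrier G = E ` A" using E by (auto simp: bij_betw_def)
  have injE: "inj_on E A" using E by (auto simp: bij_betw_def)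
  have P: "P (E a) = a" if "a \<in> A" for a
    unfolding P_def using injE that by simp
  have \<sigma>E: "\<sigma> (E a) = E (S a)" if "a \<in> A" for a using P that by (simp add: \<sigma>_def)
  have DE: "inv (E a) \<otimes> E (S a) = E (D a)" if "a \<in> A" for a
    using that D mul by (metis EA inv_solve_left S(1))
  show "finite (carrier G)" using fin carr by simp
  show "\<sigma> x \<in> carrier G" if "x \<in> carrier G" for x
    using that \<sigma>E EA S by (auto simp: carr)
  have inj: "inj_on f (carrier G)" if "\<And>a. a \<in> A \<Longrightarrow> f (E a) = E (h a)" "inj_on h A"
    "\<And>a. a \<in> A \<Longrightarrow> h a \<in> A" for f h
    unfolding carr
  proof (rule inj_onI, elim imageE)
    fix x y a b assume ab: "f x = f y" "x = E a" "y = E b" "a \<in> A" "b \<in> A"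
    then have "h a = h b" using that injE by (metis inj_onD)
    then show "x = y" using ab that(2) by (metis inj_onD)
  qed
  show "inj_on \<sigma> (carrier G)" by (rule inj[of _ S]) (use S \<sigma>E in auto)
  show "inj_on (\<lambda>x. \<sigma> x \<otimes> x) (carrier G)"
    by (rule inj[OF _ inj1]) (use S \<sigma>E mul mul_closed in auto)
  show "inj_on (\<lambda>x. inv x \<otimes> \<sigma> x) (carrier G)"
    by (rule inj[of _ D]) (use D \<sigma>E DE in auto)
  show "inj_on (\<lambda>x. inv x \<otimes> \<sigma> x \<otimes> x) (carrier G)"
    by (rule inj[OF _ inj3]) (use S D \<sigma>E DE mul mul_closed in auto)
qed

text \<open>With coset representatives r, put sigma(r(y) n) = r(tau y) phi_y(n). Each of the four
  maps on G covers the corresponding map of the colouring tau on H, which is injective, so a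
  collision can only occur inside one fibre; there the hypothesis \<open>fibre\<close> for s = r(tau
  y), t = r(y) excludes it.\<close>

lemma (in group_hom) colourable_extension:
  assumes fin: "finite (carrier G)" and surj: "h ` carrier G = carrier H"
    and col: "colourable H"
    and fibre: "\<And>s t. s \<in> carrier G \<Longrightarrow> t \<in> carrier G \<Longrightarrow> \<exists>\<phi>.
      (\<forall>n\<in>kernel G H h. \<phi> n \<in> kernel G H h) \<and> inj_on \<phi> (kernel G H h) \<and>
      inj_on (\<lambda>n. s \<otimes> \<phi> n \<otimes> (t \<otimes> n)) (kernel G H h) \<and>
      inj_on (\<lambda>n. inv (t \<otimes> n) \<otimes> (s \<otimes> \<phi> n)) (kernel G H h) \<and>
      inj_on (\<lambda>n. inv (t \<otimes> n) \<otimes> (s \<otimes> \<phi> n) \<otimes> (t \<otimes> n)) (kernel G H h)"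
  shows "colourable G"
proof -
  let ?N = "kernel G H h"
  obtain \<tau> where "colouring_bijection H \<tau>" using col by (auto simp: colourable_def)
  then have \<tau>: "inj_on \<tau> (carrier H)" "\<And>x. x \<in> carrier H \<Longrightarrow> \<tau> x \<in> carrier H"
    and \<tau>1: "inj_on (\<lambda>x. \<tau> x \<otimes>\<^bsub>H\<^esub> x) (carrier H)"
    and \<tau>2: "inj_on (\<lambda>x. inv\<^bsub>H\<^esub> x \<otimes>\<^bsub>H\<^esub> \<tau> x) (carrier H)"
    and \<tau>3: "inj_on (\<lambda>x. inv\<^bsub>H\<^esub> x \<otimes>\<^bsub>H\<^esub> \<tau> x \<otimes>\<^bsub>H\<^esub> x) (carrier H)"
    unfolding colouring_bijection_def Delta1_def Delta2_def Delta3_def bij_betw_def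
    by (auto simp: Delta1_def Delta2_def Delta3_def cong: inj_on_cong)
  define r where "r = inv_into (carrier G) h"
  have r: "r y \<in> carrier G" "h (r y) = y" if "y \<in> carrier H" for y
    using that surj by (auto simp: r_def inv_into_into f_inv_into_f)
  have "\<exists>\<phi>. \<forall>y\<in>carrier H. (\<forall>n\<in>?N. \<phi> y n \<in> ?N) \<and> inj_on (\<phi> y) ?N \<and>
      inj_on (\<lambda>n. r (\<tau> y) \<otimes> \<phi> y n \<otimes> (r y \<otimes> n)) ?N \<and>
      inj_on (\<lambda>n. inv (r y \<otimes> n) \<otimes> (r (\<tau> y) \<otimes> \<phi> y n)) ?N \<and>
      inj_on (\<lambda>n. inv (r y \<otimes> n) \<otimes> (r (\<tau> y) \<otimes> \<phi> y n) \<otimes> (r y \<otimes> n)) ?N"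
    by (rule bchoice) (intro ballI fibre r(1) \<tau>(2))
  then obtain \<phi> where \<phi>: "\<And>y. y \<in> carrier H \<Longrightarrow> (\<forall>n\<in>?N. \<phi> y n \<in> ?N) \<and> inj_on (\<phi> y) ?N \<and>
      inj_on (\<lambda>n. r (\<tau> y) \<otimes> \<phi> y n \<otimes> (r y \<otimes> n)) ?N \<and>
      inj_on (\<lambda>n. inv (r y \<otimes> n) \<otimes> (r (\<tau> y) \<otimes> \<phi> y n)) ?N \<and>
      inj_on (\<lambda>n. inv (r y \<otimes> n) \<otimes> (r (\<tau> y) \<otimes> \<phi> y n) \<otimes> (r y \<otimes> n)) ?N"
    by blast
  \<comment> \<open>The kernel coordinate of x relative to the chosen representative of its
    coset.\<close>
  define \<nu> where "\<nu> x = inv (r (h x)) \<otimes> x" for x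
  define \<sigma> where "\<sigma> x = r (\<tau> (h x)) \<otimes> \<phi> (h x) (\<nu> x)" for x
  have \<nu>: "\<nu> x \<in> ?N" "x = r (h x) \<otimes> \<nu> x" "h x \<in> carrier H" if "x \<in> carrier G" for x
    using that r by (auto simp: \<nu>_def kernel_def G.m_assoc[symmetric])
  have N: "n \<in> carrier G" "h n = \<one>\<^bsub>H\<^esub>" if "n \<in> ?N" for n using that by (auto simp: kernel_def)
  have \<phi>c: "\<phi> y n \<in> carrier G" "h (\<phi> y n) = \<one>\<^bsub>H\<^esub>" if "y \<in> carrier H" "n \<in> ?N" for y n
    using \<phi>[OF that(1)] that(2) N by auto
  have \<sigma>c: "\<sigma> x \<in> carrier G" "h (\<sigma> x) = \<tau> (h x)" if "x \<in> carrier G" for x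
    using that \<nu> r \<tau> \<phi>c by (auto simp: \<sigma>_def)
  have inj: "inj_on f (carrier G)"
    if f: "\<And>x. x \<in> carrier G \<Longrightarrow> h (f x) = g (h x)" "inj_on g (carrier H)"
      "\<And>x. x \<in> carrier G \<Longrightarrow> f x = k (h x) (\<nu> x)" "\<And>y. y \<in> carrier H \<Longrightarrow> inj_on (k y) ?N" for f g k
  proof (rule inj_onI)
    fix x y assume xy: "x \<in> carrier G" "y \<in> carrier G" "f x = f y"
    then have "g (h x) = g (h y)" using f(1) by metis
    then have e: "h x = h y" using f(2) xy \<nu> by (auto dest: inj_onD)
    then have "k (h x) (\<nu> x) = k (h x) (\<nu> y)" using f(3) xy by metis
    then have "\<nu> x = \<nu> y" using f(4)[of "h x"] \<nu> xy by (auto dest: inj_onD)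
    then show "x = y" using e \<nu>(2) xy by metis
  qed
  show ?thesis
  proof (rule G.colourableI[OF fin \<sigma>c(1)])
    show "inj_on \<sigma> (carrier G)"
    proof (rule inj[OF _ \<tau>(1)])
      show "inj_on (\<lambda>n. r (\<tau> y) \<otimes> \<phi> y n) ?N" if "y \<in> carrier H" for y
        proof (rule inj_onI)
        fix m n assume mn: "m \<in> ?N" "n \<in> ?N" "r (\<tau> y) \<otimes> \<phi> y m = r (\<tau> y) \<otimes> \<phi> y n"
        then have "\<phi> y m = \<phi> y n" using \<phi>c[OF that] r(1) \<tau>(2)[OF that] by simp
        then show "m = n" using \<phi>[OF that] mn by (auto dest: inj_onD)
      qed
    qed (simp_all add: \<sigma>c, simp add: \<sigma>_def)
    show "inj_on (\<lambda>x. \<sigma> x \<otimes> x) (carrier G)"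
    proof (rule inj[OF _ \<tau>1])
      show "\<sigma> x \<otimes> x = r (\<tau> (h x)) \<otimes> \<phi> (h x) (\<nu> x) \<otimes> (r (h x) \<otimes> \<nu> x)" if "x \<in> carrier G" for x
        by (simp add: \<sigma>_def flip: \<nu>(2)[OF that])
    qed (simp_all add: \<sigma>c \<phi>)
    show "inj_on (\<lambda>x. inv x \<otimes> \<sigma> x) (carrier G)"
    proof (rule inj[OF _ \<tau>2])
      show "inv x \<otimes> \<sigma> x = inv (r (h x) \<otimes> \<nu> x) \<otimes> (r (\<tau> (h x)) \<otimes> \<phi> (h x) (\<nu> x))"
        if "x \<in> carrier G" for x
        by (simp add: \<sigma>_def flip: \<nu>(2)[OF that])
    qed (simp_all add: \<sigma>c \<phi>)
    show "inj_on (\<lambda>x. inv x \<otimes> \<sigma> x \<otimes> x) (carrier G)"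
    proof (rule inj[OF _ \<tau>3])
      show "inv x \<otimes> \<sigma> x \<otimes> x =
          inv (r (h x) \<otimes> \<nu> x) \<otimes> (r (\<tau> (h x)) \<otimes> \<phi> (h x) (\<nu> x)) \<otimes> (r (h x) \<otimes> \<nu> x)"
        if "x \<in> carrier G" for x
        by (simp add: \<sigma>_def flip: \<nu>(2)[OF that])
    qed (simp_all add: \<sigma>c \<phi>)
  qed
qed

text \<open>Quotients are realised on natural numbers so that inductions over groups stay within one
  type.\<close>

lemma quotient_on_nat:
  fixes G (structure)
  assumes "normal N G" "finite (carrier G)"
  obtains H :: "nat monoid" and \<pi>
  where "group H" "group_hom G H \<pi>" "\<pi> ` carrier G = carrier H" "kernel G H \<pi> = N"
    "order G = card N * order H"
proof -
  interpret normal N G by fact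
  interpret Q: group "G Mod N" by (rule factorgroup_is_group)
  have finQ: "finite (carrier (G Mod N))"
    unfolding FactGroup_def RCOSETS_def using assms(2) by auto
  obtain f :: "_ \<Rightarrow> nat" where f: "inj_on f (carrier (G Mod N))"
    using finite_imp_inj_to_nat_seg[OF finQ] by blast
  define g where "g = the_inv_into (carrier (G Mod N)) f"
  have gf: "g (f x) = x" if "x \<in> carrier (G Mod N)" for x
    using f that by (simp add: g_def the_inv_into_f_f)
  \<comment> \<open>\<open>H0\<close> merely holds the transported product and need not be a group
    itself; the image of \<open>f\<close> inside it is one, by transport along a
    homomorphism.\<close>
  define H0 :: "nat monoid" where "H0 = \<lparr>carrier = UNIV,
    monoid.mult = (\<lambda>a b. f (g a \<otimes>\<^bsub>G Mod N\<^esub> g b)), one = f \<one>\<^bsub>G Mod N\<^esub>\<rparr>"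
  have fH0: "f \<in> hom (G Mod N) H0"
    by (auto simp: hom_def H0_def gf)
  define H where "H = H0\<lparr>carrier := f ` carrier (G Mod N), one := f \<one>\<^bsub>G Mod N\<^esub>\<rparr>"
  have H: "group H" unfolding H_def by (rule Q.hom_imp_img_group[OF fH0])
  define \<pi> where "\<pi> x = f (N #> x)" for x
  have cQ: "carrier (G Mod N) = (\<lambda>x. N #> x) ` carrier G"
    by (auto simp: FactGroup_def RCOSETS_def)
  have hom: "\<pi> \<in> hom G H"
    using cQ by (auto simp: hom_def H_def H0_def \<pi>_def gf FactGroup_def rcos_sum)
  have gh: "group_hom G H \<pi>"
    using hom H by (simp add: group_hom_def group_hom_axioms_def is_group)
  have surj: "\<pi> ` carrier G = carrier H"
    by (auto simp: H_def \<pi>_def cQ)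
  have "\<one>\<^bsub>H\<^esub> = f N" by (simp add: H_def FactGroup_def)
  then have ker: "kernel G H \<pi> = N"
  proof -
    have "f (N #> x) = f N \<longleftrightarrow> x \<in> N" if "x \<in> carrier G" for x
    proof -
      have "N \<in> carrier (G Mod N)" using Q.one_closed by (simp add: FactGroup_def)
      then have "f (N #> x) = f N \<longleftrightarrow> N #> x = N"
        using f cQ that by (auto dest: inj_onD)
      also have "\<dots> \<longleftrightarrow> x \<in> N"
        using that by (metis coset_join1 coset_join2 subgroup_axioms subset)
      finally show ?thesis .
    qed
    then show ?thesis using \<open>\<one>\<^bsub>H\<^esub> = f N\<close> subset by (auto simp: kernel_def \<pi>_def)
  qed
  have "order H = card (rcosets N)"
    using card_image[OF f] by (simp add: order_def H_def FactGroup_def)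
  then have "order G = card N * order H"
    using lagrange[OF subgroup_axioms] by (simp add: mult.commute)
  with H gh surj ker that show ?thesis by blast
qed

text \<open>Class equation modulo p: N is a union of conjugation orbits, each of size 1 or divisible
  by p. If the identity were the only fixed point, p would divide both card N - 1 and card
  N.\<close>

lemma (in group) normal_subgroup_meets_center:
  fixes p :: nat
  assumes p: "Factorial_Ring.prime p" and ord: "order G = p ^ n" and N: "N \<lhd> G" and nontriv: "N \<noteq> {\<one>}"
  shows "\<exists>z\<in>N. z \<noteq> \<one> \<and> (\<forall>x\<in>carrier G. x \<otimes> z = z \<otimes> x)"
proof -
  interpret normal N G by fact
  have "p ^ n > 0" using p by (simp add: prime_gt_0_nat)
  then have fin: "finite (carrier G)" using ord by (metis card_ge_0_finite order_def)
  then have finN: "finite N" using subset finite_subset by blast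
  define act where "act = (\<lambda>g. \<lambda>h\<in>carrier G. g \<otimes> h \<otimes> inv g)"
  interpret A: group_action G "carrier G" act
    unfolding act_def by (rule action_by_conjugation)
  define orb where "orb z = (\<lambda>g. g \<otimes> z \<otimes> inv g) ` carrier G" for z
  have orb_eq: "orbit G act z = orb z" if "z \<in> carrier G" for z
    using that by (auto simp: orbit_def orb_def act_def)
  have orbN: "orb z \<subseteq> N" if "z \<in> N" for z
    using that by (auto simp: orb_def inv_op_closed2)
  have cards: "card (orb z) = 1 \<or> p dvd card (orb z)" if "z \<in> N" for z
  proof -
    have "card (orb z) dvd p ^ n"
      using A.orbit_stabilizer_theorem[of z] that subset ord orb_eq by (metis dvd_triv_left subsetD)
    then obtain i where "card (orb z) = p ^ i" using p divides_primepow_nat by metis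
    then show ?thesis by (cases i) auto
  qed
  have self: "z \<in> orb z" if "z \<in> N" for z
    using that subset by (auto simp: orb_def intro!: image_eqI[of _ _ \<one>])
  have central: "\<forall>x\<in>carrier G. x \<otimes> z = z \<otimes> x" if "z \<in> N" "card (orb z) = 1" for z
  proof
    fix x assume x: "x \<in> carrier G"
    have "x \<otimes> z \<otimes> inv x \<in> orb z" using x by (auto simp: orb_def)
    then have "x \<otimes> z \<otimes> inv x = z" using that self by (metis card_1_singletonE singletonD)
    then have "x \<otimes> z \<otimes> inv x \<otimes> x = z \<otimes> x" by simp
    then show "x \<otimes> z = z \<otimes> x" using x that subset by (auto simp: m_assoc)
  qed
  show ?thesis
  proof (rule ccontr)
    assume neg: "\<not> ?thesis"
    let ?O = "orb ` (N - {\<one>})"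
    have part: "disjoint (orb ` N)"
    proof (rule disjointI)
      fix a b assume ab: "a \<in> orb ` N" "b \<in> orb ` N" "a \<noteq> b"
      have "orb z \<in> orbits G (carrier G) act" if "z \<in> N" for z
        using that orb_eq[of z] subset by (force simp: orbits_def)
      then have "a \<in> orbits G (carrier G) act" "b \<in> orbits G (carrier G) act"
        using ab by auto
      then show "a \<inter> b = {}" using A.disjoint_union ab(3) by blast
    qed
    have nz: "\<one> \<notin> orb z" if "z \<in> N - {\<one>}" for z
    proof
      assume "\<one> \<in> orb z"
      then obtain g where g: "g \<in> carrier G" "\<one> = g \<otimes> z \<otimes> inv g" by (auto simp: orb_def)
      moreover have "z \<in> carrier G" using that subset by auto
      ultimately have "g \<otimes> z \<otimes> inv g \<otimes> g = g" "z \<in> carrier G" by (simp_all flip: g(2))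
      then have "z = \<one>" using g(1) by (simp add: m_assoc)
      then show False using that by simp
    qed
    have un: "N - {\<one>} = \<Union> ?O"
      using self orbN nz by fastforce
    have "card (N - {\<one>}) = card (\<Union> ?O)" by (rule arg_cong[OF un])
    also have "\<dots> = sum card ?O"
    proof (rule card_Union_disjoint)
      show "disjoint ?O" by (rule pairwise_subset[OF part]) auto
      show "finite A" if "A \<in> ?O" for A using that orbN finN finite_subset by blast
    qed
    finally have "card (N - {\<one>}) = sum card ?O" .
    moreover have "p dvd sum card ?O"
      using cards central neg by (intro dvd_sum) (auto, metis)
    ultimately have "p dvd card N - 1" using finN by simp
    moreover have "p dvd card N"
    proof -
      have "card N dvd p ^ n" using lagrange[OF subgroup_axioms] ord by (metis dvd_triv_right)
      then obtain i where i: "card N = p ^ i" using p divides_primepow_nat by metis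
      have "card N \<noteq> 1" using nontriv subgroup.one_closed[OF subgroup_axioms] by (metis card_1_singletonE singletonD)
      then show ?thesis using i by (cases i) auto
    qed
    moreover have "card N > 0" unfolding card_gt_0_iff using finN subgroup.one_closed[OF subgroup_axioms] by blast
    ultimately have "p dvd 1" by (metis Suc_diff_1 dvd_add_right_iff plus_1_eq_Suc add.commute)
    then show False using p by simp
  qed
qed

section \<open>Twisted planes\<close>

lemma (in group) int_pow_commute:
  assumes "x \<in> carrier G" "y \<in> carrier G" "x \<otimes> y = y \<otimes> x"
  shows "x [^] (k::int) \<otimes> y = y \<otimes> x [^] k"
proof -
  have nat: "x [^] n \<otimes> y = y \<otimes> x [^] n" for n :: nat
    using group_commutes_pow assms by blast
  have inv: "inv a \<otimes> y = y \<otimes> inv a" if "a \<in> carrier G" "a \<otimes> y = y \<otimes> a" for a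
  proof -
    have "inv a \<otimes> y = inv a \<otimes> (y \<otimes> a) \<otimes> inv a"
      using that(1) assms(1,2) by (simp add: m_assoc)
    also have "\<dots> = inv a \<otimes> (a \<otimes> y) \<otimes> inv a" by (simp only: that(2))
    also have "\<dots> = y \<otimes> inv a" using that(1) assms(1,2) by (simp flip: m_assoc)
    finally show ?thesis .
  qed
  have "inv (x [^] n) \<otimes> y = y \<otimes> inv (x [^] n)" for n :: nat
    by (rule inv[OF _ nat]) (use assms(1) in simp)
  then show ?thesis using nat unfolding int_pow_def2 by presburger
qed

lemma (in group) conj_int_pow:
  assumes "t \<in> carrier G" "x \<in> carrier G"
  shows "t \<otimes> x [^] (k::int) \<otimes> inv t = (t \<otimes> x \<otimes> inv t) [^] k"
proof -
  interpret c: group_hom G G "\<lambda>y. t \<otimes> y \<otimes> inv t"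
  proof unfold_locales
    show "(\<lambda>y. t \<otimes> y \<otimes> inv t) \<in> hom G G"
    proof (rule homI)
      fix y z assume yz: "y \<in> carrier G" "z \<in> carrier G"
      have "t \<otimes> y \<otimes> inv t \<otimes> (t \<otimes> z \<otimes> inv t) = t \<otimes> y \<otimes> (inv t \<otimes> t) \<otimes> z \<otimes> inv t"
        using yz assms(1) by (simp only: m_assoc m_closed inv_closed)
      then show "t \<otimes> (y \<otimes> z) \<otimes> inv t = t \<otimes> y \<otimes> inv t \<otimes> (t \<otimes> z \<otimes> inv t)"
        using yz assms(1) by (simp add: m_assoc)
    qed (use assms in auto)
  qed
  show ?thesis using c.hom_int_pow[OF assms(2)] .
qed

text \<open>Injectivity on Z/m x Z/3, phrased as distinctness of a finite list so that evaluation
  can decide it.\<close>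

definition inj_mod :: "int \<Rightarrow> (int \<Rightarrow> int \<Rightarrow> int) \<Rightarrow> (int \<Rightarrow> int \<Rightarrow> int) \<Rightarrow> bool" where
  "inj_mod m f g \<longleftrightarrow>
    distinct (map (\<lambda>(x, i). (f x i mod m, g x i mod 3)) (List.product [0..m - 1] [0..2]))"

lemma inj_modD:
  assumes "inj_mod m f g" "{x, y} \<subseteq> {0..<m}" "{i, j} \<subseteq> {0..<3}"
    and "m dvd f x i - f y j" "3 dvd g x i - g y j"
  shows "x = y \<and> i = j"
proof -
  have "set (List.product [0..m - 1] [0..2::int]) = {0..<m} \<times> {0..<3}" by auto
  then have "inj_on (\<lambda>(x, i). (f x i mod m, g x i mod 3)) ({0..<m} \<times> {0..<3})"
    using assms(1) unfolding inj_mod_def distinct_map by simp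
  from inj_onD[OF this, of "(x, i)" "(y, j)"] show ?thesis
    using assms(2-) by (auto simp: mod_eq_dvd_iff)
qed

text \<open>
  Elements of the plane are \<open>c\<^sup>x u\<^sup>i\<close>.  In the fibre over \<open>t\<close>, mapped to the fibre over \<open>s\<close>, take
  \<open>t c\<^sup>x u\<^sup>i \<mapsto> s c\<^bsup>a x i\<^esup> u\<^bsup>b x i\<^esup>\<close>; if \<open>t\<close> and \<open>s\<close> act on \<open>u\<close> by the twists \<open>p\<close> and \<open>q\<close>, the four
  conditions are the injectivity of this map and of its three differences, read off in exponents.
\<close>

definition plane_colouring :: "int \<Rightarrow> int \<Rightarrow> int \<Rightarrow> (int \<Rightarrow> int \<Rightarrow> int) \<Rightarrow> (int \<Rightarrow> int \<Rightarrow> int) \<Rightarrow> bool" where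
  "plane_colouring m p q a b \<longleftrightarrow> inj_mod m a b \<and>
    inj_mod m (\<lambda>x i. a x i + x - m div 3 * p * b x i) (\<lambda>x i. b x i + i) \<and>
    inj_mod m (\<lambda>x i. a x i - x + m div 3 * (q - p) * i) (\<lambda>x i. b x i - i) \<and>
    inj_mod m (\<lambda>x i. a x i + m div 3 * (q * i - p * b x i)) b"

text \<open>The map (x, i) to (\<alpha> x + \<beta> i, x) is linear over F_3, and so are the three
  maps derived from it. The conditions say that four determinants do not vanish modulo 3: \<beta>
  and \<beta> + q are nonzero, \<alpha> - \<beta> differs from p - 1, and \<alpha> + \<beta> differs
  from 1 + p - q. The tables list a solution for each (p, q).\<close>

lemma plane_colouring_3:
  "\<forall>p\<in>set [0..2]. \<forall>q\<in>set [0..2]. plane_colouring 3 p q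
    (\<lambda>x i. [[0, 1, 2], [0, 2, 0], [0, 0, 1]] ! nat p ! nat q * x +
      [[2, 1, 2], [1, 1, 2], [1, 1, 2]] ! nat p ! nat q * i) (\<lambda>x i. x)"
  by code_simp

text \<open>Modulo 9 the value 3x + i determines i and x mod 3 but loses the leading ternary digit x
  div 3, which the second coordinate records. Its other terms depend modulo 3 only on i and x mod 3,
  so they do not disturb this; they are adjusted to p and q so that the remaining maps become
  injective as well.\<close>

lemma plane_colouring_9:
  "\<forall>p\<in>set [0..2]. \<forall>q\<in>set [0..2]. plane_colouring 9 p q (\<lambda>x i. 3 * x + i)
    (\<lambda>x i. x div 3 + (if x mod 3 = q then q else 0)
      + (if i = 1 then p - x else if i = 2 then 1 - p - q else 0))"
  by code_simp

lemma plane_colouring_exists: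
  assumes "m = 3 \<or> m = 9" "p \<in> {0, 1, 2}" "q \<in> {0, 1, 2}"
  shows "\<exists>a b. plane_colouring m p q a b"
proof -
  have "p \<in> set [0..2]" "q \<in> set [0..2]" using assms by auto
  then show ?thesis using assms(1) plane_colouring_3 plane_colouring_9 by blast
qed


text \<open>By \<open>c_pow\<close>, \<open>u3\<close> and \<open>u_notin\<close> the products of
  powers of c and u form a copy of Z/m x Z/3. By \<open>conj\<close> every element of G fixes c and
  moves u only by a power of c^(m/3), an element of order 3; hence the exponent p matters only
  modulo 3.\<close>

locale twisted_plane = group G for G (structure) +
  fixes m :: int and c u :: 'a
  assumes m: "m = 3 \<or> m = 9"
    and c_closed [simp]: "c \<in> carrier G" and u_closed [simp]: "u \<in> carrier G"
    and central: "x \<in> carrier G \<Longrightarrow> x \<otimes> c = c \<otimes> x"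
    and c_pow: "c [^] (k::int) = \<one> \<longleftrightarrow> m dvd k"
    and u3: "u [^] (3::int) = \<one>"
    and u_notin: "u \<noteq> c [^] (k::int)"
    and conj: "x \<in> carrier G \<Longrightarrow> \<exists>p. x \<otimes> u = c [^] (m div 3 * p) \<otimes> u \<otimes> x"
begin

definition el :: "int \<Rightarrow> int \<Rightarrow> 'a" where "el x i = c [^] x \<otimes> u [^] i"

definition plane :: "'a set" where "plane = {el x i | x i. True}"

definition twist :: "'a \<Rightarrow> int \<Rightarrow> bool" where
  "twist t p \<longleftrightarrow> t \<otimes> u = c [^] (m div 3 * p) \<otimes> u \<otimes> t"

lemma m_pos: "m > 0" using m by auto

lemma m_div: "m div 3 * 3 = m" using m by auto

lemma el_closed [simp]: "el x i \<in> carrier G"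
  by (simp add: el_def)

lemma el_in_plane [simp]: "el x i \<in> plane"
  by (auto simp: plane_def)

lemma planeE:
  assumes "n \<in> plane" obtains x i where "n = el x i"
  using assms by (auto simp: plane_def)

lemma c_commute: "y \<in> carrier G \<Longrightarrow> c [^] (k::int) \<otimes> y = y \<otimes> c [^] k"
  using int_pow_commute[of c y k] central by simp

lemma el_mult: "el x i \<otimes> el y j = el (x + y) (i + j)"
proof -
  have "el x i \<otimes> el y j = c [^] x \<otimes> (u [^] i \<otimes> c [^] y) \<otimes> u [^] j"
    by (simp add: el_def m_assoc)
  also have "\<dots> = el (x + y) (i + j)"
    unfolding c_commute[OF int_pow_closed[OF u_closed], symmetric]
    by (simp add: el_def m_assoc int_pow_mult)
  finally show ?thesis .
qed

lemma el_0: "el 0 0 = \<one>" by (simp add: el_def)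

lemma el_c: "el x 0 = c [^] x" and el_u: "el 0 i = u [^] i" by (simp_all add: el_def)

lemma el_inv: "inv (el x i) = el (- x) (- i)"
  by (rule inv_equality) (simp_all add: el_mult el_0)

lemma u_pow_notin:
  assumes "\<not> 3 dvd i" shows "u [^] (i::int) \<noteq> c [^] (k::int)"
proof
  assume *: "u [^] i = c [^] k"
  have per: "u [^] (3 * j) = \<one>" for j :: int using int_pow_pow[of u 3 j] u3 by simp
  from assms have "i mod 3 = 1 \<or> i mod 3 = 2" by presburger
  then show False
  proof
    assume "i mod 3 = 1"
    then have "i = 1 + 3 * (i div 3)" by presburger
    then have "u [^] i = u" using int_pow_mult[of u 1 "3 * (i div 3)"] per by simp
    then show False using * u_notin[of k] by simp
  next
    assume "i mod 3 = 2"
    then have "1 = - i + 3 * (i div 3 + 1)" by presburger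
    then have "u [^] (1::int) = u [^] (- i) \<otimes> \<one>"
      using int_pow_mult[of u "- i" "3 * (i div 3 + 1)"] by (simp only: u_closed simp_thms per)
    then have "u = inv (c [^] k)" using * by (simp add: int_pow_neg)
    then show False using u_notin[of "- k"] by (simp add: int_pow_neg)
  qed
qed

lemma el_eq_one_iff: "el x i = \<one> \<longleftrightarrow> m dvd x \<and> 3 dvd i"
proof
  assume e: "el x i = \<one>"
  then have "u [^] i = inv (c [^] x)"
    unfolding el_def by (metis c_closed u_closed int_pow_closed inv_equality inv_inv inv_closed)
  then have "3 dvd i" using u_pow_notin[of i "- x"] by (auto simp: int_pow_neg)
  then obtain j where "i = 3 * j" by blast
  then have "u [^] i = \<one>" using int_pow_pow[of u 3 j] u3 by simp
  then show "m dvd x \<and> 3 dvd i" using e c_pow \<open>3 dvd i\<close> by (simp add: el_def)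
next
  assume "m dvd x \<and> 3 dvd i"
  then obtain j where "m dvd x" "i = 3 * j" by blast
  then show "el x i = \<one>" using int_pow_pow[of u 3 j] u3 c_pow by (simp add: el_def)
qed

lemma el_eq_iff: "el x i = el y j \<longleftrightarrow> m dvd x - y \<and> 3 dvd i - j"
proof -
  have "el x i = el y j \<longleftrightarrow> el x i \<otimes> inv (el y j) = \<one>"
    by (metis el_closed inv_closed inv_inv inv_equality r_inv)
  then show ?thesis by (simp add: el_inv el_mult el_eq_one_iff)
qed

lemma twist_el:
  assumes "twist t p" "t \<in> carrier G"
  shows "t \<otimes> el x i = el (x + m div 3 * p * i) i \<otimes> t"
proof -
  have e: "c [^] (m div 3 * p) \<otimes> u = el (m div 3 * p) 1" by (simp add: el_def)
  have "t \<otimes> u \<otimes> inv t = el (m div 3 * p) 1"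
    using assms by (simp add: twist_def m_assoc el_def)
  then have "t \<otimes> u [^] i \<otimes> inv t = (c [^] (m div 3 * p) \<otimes> u) [^] i"
    using conj_int_pow[of t u i] assms by (simp add: el_def)
  also have "\<dots> = el (m div 3 * p * i) i"
    by (subst int_pow_mult_distrib) (simp_all add: c_commute int_pow_pow el_def)
  finally have "t \<otimes> u [^] i \<otimes> inv t \<otimes> t = el (m div 3 * p * i) i \<otimes> t" by simp
  then have "t \<otimes> u [^] i = el (m div 3 * p * i) i \<otimes> t" using assms by (simp add: m_assoc)
  moreover have "t \<otimes> el x i = c [^] x \<otimes> (t \<otimes> u [^] i)"
  proof -
    have "t \<otimes> el x i = c [^] x \<otimes> t \<otimes> u [^] i"
      using assms(2) by (simp add: el_def c_commute[OF assms(2)] m_assoc)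
    then show ?thesis using assms(2) by (simp add: m_assoc)
  qed
  ultimately show ?thesis
    using el_mult[of x 0 "m div 3 * p * i" i] assms by (simp add: el_c flip: m_assoc)
qed

lemma twist_el':
  assumes "twist t p" "t \<in> carrier G"
  shows "el x i \<otimes> t = t \<otimes> el (x - m div 3 * p * i) i"
  using twist_el[OF assms, of "x - m div 3 * p * i" i] by simp

lemma twistI: "t \<in> carrier G \<Longrightarrow> t \<otimes> u = el (m div 3 * p) 1 \<otimes> t \<Longrightarrow> twist t p"
  by (simp add: twist_def el_def)

text \<open>Twists add, so modulo 3 they form a homomorphism from G to Z/3. This gives the twist of
  t^-1 s in the fibre computation and the triviality of the twist of a cube.\<close>

lemma twist_mult:
  assumes "twist s q" "s \<in> carrier G" "twist t p" "t \<in> carrier G"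
  shows "twist (s \<otimes> t) (q + p)"
proof (rule twistI)
  have "s \<otimes> t \<otimes> u = s \<otimes> (t \<otimes> el 0 1)" using assms by (simp add: el_u m_assoc)
  also have "\<dots> = s \<otimes> el (m div 3 * p) 1 \<otimes> t"
    using assms twist_el[OF assms(3,4), of 0 1] by (simp add: m_assoc)
  also have "\<dots> = el (m div 3 * (q + p)) 1 \<otimes> (s \<otimes> t)"
    using assms twist_el[OF assms(1,2), of "m div 3 * p" 1] by (simp add: m_assoc algebra_simps)
  finally show "s \<otimes> t \<otimes> u = el (m div 3 * (q + p)) 1 \<otimes> (s \<otimes> t)" .
qed (use assms in auto)

lemma twist_inv:
  assumes "twist t p" "t \<in> carrier G"
  shows "twist (inv t) (- p)"
proof (rule twistI)
  have "inv t \<otimes> u = inv t \<otimes> (el 0 1 \<otimes> t) \<otimes> inv t"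
    using assms by (simp add: el_u m_assoc)
  also have "\<dots> = inv t \<otimes> (t \<otimes> el (- (m div 3 * p)) 1) \<otimes> inv t"
    using twist_el'[OF assms, of 0 1] by simp
  also have "\<dots> = el (m div 3 * - p) 1 \<otimes> inv t"
    using assms by (simp flip: m_assoc)
  finally show "inv t \<otimes> u = el (m div 3 * - p) 1 \<otimes> inv t" .
qed (use assms in auto)

lemma twist_exists: "t \<in> carrier G \<Longrightarrow> \<exists>p\<in>{0, 1, 2}. twist t p"
proof -
  assume "t \<in> carrier G"
  from conj[OF this] obtain p where p: "twist t p" unfolding twist_def ..
  have "m div 3 * p = m div 3 * (p mod 3) + m * (p div 3)"
    by (metis distrib_left m_div mult.assoc mult_div_mod_eq add.commute)
  then have "el (m div 3 * p) 1 = el (m div 3 * (p mod 3)) 1" by (simp add: el_eq_iff)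
  then have "twist t (p mod 3)" using p by (simp add: twist_def el_def)
  moreover have "p mod 3 \<in> {0, 1, 2}" by auto
  ultimately show ?thesis by (rule bexI)
qed

lemma subgroup_plane: "subgroup plane G"
proof
  show "plane \<subseteq> carrier G" by (auto simp: plane_def)
  show "\<one> \<in> plane" using el_in_plane[of 0 0] by (simp add: el_0)
qed (auto elim!: planeE simp: el_mult el_inv)

lemma normal_plane: "plane \<lhd> G"
proof (rule normal_invI[OF subgroup_plane])
  fix t n assume t: "t \<in> carrier G" and "n \<in> plane"
  then obtain x i where n: "n = el x i" by (auto elim: planeE)
  obtain p where "twist t p" using twist_exists t by blast
  from twist_el[OF this t, of x i] show "t \<otimes> n \<otimes> inv t \<in> plane"
    using t by (simp add: n m_assoc)
qed

lemma plane_reduced: "plane = (\<lambda>(x, i). el x i) ` ({0..<m} \<times> {0..<3})"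
proof -
  have "el x i = el (x mod m) (i mod 3)" for x i :: int
    by (simp add: el_eq_iff mod_eq_dvd_iff[symmetric])
  moreover have "(x mod m, i mod 3) \<in> {0..<m} \<times> {0..<3}" for x i :: int using m_pos by simp
  ultimately have "el x i \<in> (\<lambda>(x, i). el x i) ` ({0..<m} \<times> {0..<3})" for x i
    by (intro image_eqI[of _ _ "(x mod m, i mod 3)"]) simp_all
  then show ?thesis unfolding plane_def by auto
qed

lemma card_plane: "int (card plane) = 3 * m"
proof -
  have "inj_on (\<lambda>(x, i). el x i) ({0..<m} \<times> {0..<3})"
  proof (rule inj_onI, clarify)
    fix x i y j :: int
    assume "x \<in> {0..<m}" "i \<in> {0..<3}" "y \<in> {0..<m}" "j \<in> {0..<3}" "el x i = el y j"
    then have "x mod m = y mod m" "i mod 3 = j mod 3" by (simp_all only: el_eq_iff mod_eq_dvd_iff)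
    then show "x = y \<and> i = j"
      using \<open>x \<in> _\<close> \<open>y \<in> _\<close> \<open>i \<in> _\<close> \<open>j \<in> _\<close> by (metis atLeastLessThan_iff mod_pos_pos_trivial)
  qed
  then have "card plane = card ({0..<m} \<times> {0..<3::int})"
    unfolding plane_reduced by (rule card_image)
  then show ?thesis using m_pos by (simp add: card_cartesian_product)
qed

lemma colourable_if_quotient:
  assumes fin: "finite (carrier G)" and gh: "group_hom G H \<pi>"
    and surj: "\<pi> ` carrier G = carrier H" and ker: "kernel G H \<pi> = plane"
    and col: "colourable H"
  shows "colourable G"
proof -
  interpret \<pi>: group_hom G H \<pi> by fact
  show ?thesis
  proof (rule \<pi>.colourable_extension[OF fin surj col], unfold ker)
    fix s t assume st: "s \<in> carrier G" "t \<in> carrier G"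
    obtain p q where p: "p \<in> {0, 1, 2}" "twist t p" and q: "q \<in> {0, 1, 2}" "twist s q"
      using st twist_exists by meson
    obtain a b where ab: "plane_colouring m p q a b"
      using plane_colouring_exists[OF m p(1) q(1)] by blast
    \<comment> \<open>The exponent functions a and b are controlled only on reduced exponents and
      need not be periodic, so \<open>\<phi>\<close> has to pick the representative of n in
      \<open>R\<close> before applying them.\<close>
    define R where "R = {0..<m} \<times> {0..<3::int}"
    define \<phi> where "\<phi> n = (let (x, i) = SOME z. z \<in> R \<and> n = (case z of (x, i) \<Rightarrow> el x i)
      in el (a x i) (b x i))" for n
    have \<phi>: "\<phi> (el x i) = el (a x i) (b x i)" if "(x, i) \<in> R" for x i
    proof -
      have "(SOME z. z \<in> R \<and> el x i = (case z of (x, i) \<Rightarrow> el x i)) = (x, i)"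
      proof (rule some_equality)
        fix z assume "z \<in> R \<and> el x i = (case z of (x, i) \<Rightarrow> el x i)"
        then obtain y j where z: "z = (y, j)" "(y, j) \<in> R" "el x i = el y j" by (cases z) auto
        then have "x mod m = y mod m" "i mod 3 = j mod 3" by (simp_all only: el_eq_iff mod_eq_dvd_iff)
        then show "z = (x, i)" using z that by (simp add: R_def)
      qed (use that in simp)
      then show ?thesis by (simp add: \<phi>_def)
    qed
    \<comment> \<open>Once s and t have been moved to the left, each of the four maps is a fixed r
      times an \<open>el\<close> of new exponents, with r = 1, st, t^-1 s, t^-1 s t respectively.
      Injectivity is then a statement about exponents only.\<close>
    have inj: "inj_on f plane"
      if "inj_mod m g h" "r \<in> carrier G"
        "\<And>x i. (x, i) \<in> R \<Longrightarrow> f (el x i) = r \<otimes> el (g x i) (h x i)" for f g h r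
    proof (rule inj_onI)
      fix n n' assume "n \<in> plane" "n' \<in> plane" and eq: "f n = f n'"
      then obtain x i y j where n: "n = el x i" "n' = el y j" "(x, i) \<in> R" "(y, j) \<in> R"
        unfolding plane_reduced R_def by auto
      then have "el (g x i) (h x i) = el (g y j) (h y j)" using that(2,3) eq by simp
      then have "x = y \<and> i = j" using n(3,4) by (intro inj_modD[OF that(1)]) (simp_all add: el_eq_iff R_def)
      then show "n = n'" using n by simp
    qed
    have ts: "twist (inv t \<otimes> s) (q - p)"
      using twist_mult[OF twist_inv[OF p(2)] _ q(2)] st by simp
    have f1: "s \<otimes> \<phi> (el x i) \<otimes> (t \<otimes> el x i) =
        s \<otimes> t \<otimes> el (a x i + x - m div 3 * p * b x i) (b x i + i)" if "(x, i) \<in> R" for x i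
    proof -
      have "s \<otimes> \<phi> (el x i) \<otimes> (t \<otimes> el x i) = s \<otimes> (el (a x i) (b x i) \<otimes> t) \<otimes> el x i"
        using st by (simp add: \<phi>[OF that] m_assoc)
      also have "\<dots> = s \<otimes> t \<otimes> (el (a x i - m div 3 * p * b x i) (b x i) \<otimes> el x i)"
        using st by (simp add: twist_el'[OF p(2)] m_assoc)
      finally show ?thesis by (simp add: el_mult algebra_simps)
    qed
    have f2: "inv (t \<otimes> el x i) \<otimes> (s \<otimes> \<phi> (el x i)) =
        inv t \<otimes> s \<otimes> el (a x i - x + m div 3 * (q - p) * i) (b x i - i)" if "(x, i) \<in> R" for x i
    proof -
      have "inv (t \<otimes> el x i) \<otimes> (s \<otimes> \<phi> (el x i)) = el (- x) (- i) \<otimes> (inv t \<otimes> s) \<otimes> el (a x i) (b x i)"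
        using st by (simp add: \<phi>[OF that] m_assoc inv_mult_group el_inv)
      also have "\<dots> = inv t \<otimes> s \<otimes> (el (- x + m div 3 * (q - p) * i) (- i) \<otimes> el (a x i) (b x i))"
        using st by (simp add: twist_el'[OF ts] m_assoc)
      finally show ?thesis by (simp add: el_mult algebra_simps)
    qed
    have f3: "inv (t \<otimes> el x i) \<otimes> (s \<otimes> \<phi> (el x i)) \<otimes> (t \<otimes> el x i) =
        inv t \<otimes> s \<otimes> t \<otimes> el (a x i + m div 3 * (q * i - p * b x i)) (b x i)"
      if "(x, i) \<in> R" for x i
    proof -
      have "inv (t \<otimes> el x i) \<otimes> (s \<otimes> \<phi> (el x i)) \<otimes> (t \<otimes> el x i) =
          inv t \<otimes> s \<otimes> (el (a x i - x + m div 3 * (q - p) * i) (b x i - i) \<otimes> t) \<otimes> el x i"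
        using st by (simp add: f2[OF that] m_assoc del: inv_mult_group)
      also have "\<dots> = inv t \<otimes> s \<otimes> t \<otimes>
          (el (a x i - x + m div 3 * (q - p) * i - m div 3 * p * (b x i - i)) (b x i - i) \<otimes> el x i)"
        using st by (simp add: twist_el'[OF p(2)] m_assoc)
      finally show ?thesis by (simp add: el_mult algebra_simps)
    qed
    have pc: "inj_mod m a b"
      "inj_mod m (\<lambda>x i. a x i + x - m div 3 * p * b x i) (\<lambda>x i. b x i + i)"
      "inj_mod m (\<lambda>x i. a x i - x + m div 3 * (q - p) * i) (\<lambda>x i. b x i - i)"
      "inj_mod m (\<lambda>x i. a x i + m div 3 * (q * i - p * b x i)) b"
      using ab by (simp_all add: plane_colouring_def)
    have "\<forall>n\<in>plane. \<phi> n \<in> plane"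
    proof
      fix n assume "n \<in> plane"
      then obtain x i where "n = el x i" "(x, i) \<in> R" unfolding plane_reduced R_def by auto
      then show "\<phi> n \<in> plane" using \<phi> by simp
    qed
    moreover have "inj_on \<phi> plane" by (rule inj[OF pc(1), of \<one>]) (simp_all add: \<phi>)
    moreover have "inj_on (\<lambda>n. s \<otimes> \<phi> n \<otimes> (t \<otimes> n)) plane"
      by (rule inj[OF pc(2) _ f1]) (use st in auto)
    moreover have "inj_on (\<lambda>n. inv (t \<otimes> n) \<otimes> (s \<otimes> \<phi> n)) plane"
      by (rule inj[OF pc(3) _ f2]) (use st in auto)
    moreover have "inj_on (\<lambda>n. inv (t \<otimes> n) \<otimes> (s \<otimes> \<phi> n) \<otimes> (t \<otimes> n)) plane"
      by (rule inj[OF pc(4) _ f3]) (use st in auto)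
    ultimately show "\<exists>\<phi>. (\<forall>n\<in>plane. \<phi> n \<in> plane) \<and> inj_on \<phi> plane \<and>
        inj_on (\<lambda>n. s \<otimes> \<phi> n \<otimes> (t \<otimes> n)) plane \<and>
        inj_on (\<lambda>n. inv (t \<otimes> n) \<otimes> (s \<otimes> \<phi> n)) plane \<and>
        inj_on (\<lambda>n. inv (t \<otimes> n) \<otimes> (s \<otimes> \<phi> n) \<otimes> (t \<otimes> n)) plane"
      by blast
  qed
qed

end

section \<open>Existence of a plane whose central generator has order 3\<close>

text \<open>A residue prime to 3 is its own inverse modulo 3; this serves below wherever an exponent
  has to be inverted.\<close>

lemma square_mod_3:
  assumes "\<not> 3 dvd (l::int)" shows "3 dvd l * l - 1"
proof -
  have "l mod 3 = 1 \<or> l mod 3 = 2" using assms by presburger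
  then have "(l mod 3) * (l mod 3) mod 3 = 1" by auto
  then have "l * l mod 3 = 1 mod 3" by (simp add: mod_mult_eq)
  then show ?thesis by (simp only: mod_eq_dvd_iff)
qed

lemma (in group) int_pow_3: "x \<in> carrier G \<Longrightarrow> x [^] (3::int) = x \<otimes> x \<otimes> x"
  using int_pow_mult[of x 2 1] int_pow_mult[of x 1 1] by simp

lemma (in group) int_pow_mod:
  assumes "x \<in> carrier G" "x [^] (e::int) = \<one>"
  shows "x [^] (k mod e) = x [^] k"
proof -
  have "x [^] k = x [^] (e * (k div e)) \<otimes> x [^] (k mod e)"
    using int_pow_mult[OF assms(1), of "e * (k div e)" "k mod e"] by simp
  then show ?thesis using int_pow_pow[OF assms(1), of e "k div e"] assms by simp
qed

text \<open>Collecting the factors of (xy)^3 requires three exchanges of y with x, each contributing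
  z, and z^3 = 1.\<close>

lemma (in group) pow3_mult_of_central_commutator:
  assumes "x \<in> carrier G" "y \<in> carrier G" "z \<in> carrier G"
    and comm: "y \<otimes> x = z \<otimes> (x \<otimes> y)" and central: "\<And>v. v \<in> carrier G \<Longrightarrow> v \<otimes> z = z \<otimes> v"
    and z3: "z [^] (3::int) = \<one>"
  shows "(x \<otimes> y) [^] (3::int) = x [^] (3::int) \<otimes> y [^] (3::int)"
proof -
  note [simp] = assms(1-3)
  have yx: "y \<otimes> (x \<otimes> v) = z \<otimes> (x \<otimes> (y \<otimes> v))" if "v \<in> carrier G" for v
    using comm that by (metis assms(1-3) m_assoc m_closed)
  have zc: "v \<otimes> (z \<otimes> v') = z \<otimes> (v \<otimes> v')" if "v \<in> {x, y}" "v' \<in> carrier G" for v v'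
    using central that by (metis assms(1-3) insertE m_assoc singletonD)
  have "(x \<otimes> y) [^] (3::int) = z \<otimes> z \<otimes> z \<otimes> (x [^] (3::int) \<otimes> y [^] (3::int))"
    by (simp add: int_pow_3 m_assoc yx zc)
  then show ?thesis using z3 by (simp add: int_pow_3)
qed

lemma (in group) order_le_of_generator:
  assumes "x \<in> carrier G" "\<And>y. y \<in> carrier G \<Longrightarrow> \<exists>k::int. y = x [^] k" "x [^] (e::int) = \<one>" "e > 0"
  shows "int (order G) \<le> e"
proof -
  have "carrier G \<subseteq> (\<lambda>k. x [^] k) ` {0..<e}"
  proof
    fix y assume "y \<in> carrier G"
    then obtain k :: int where "y = x [^] k" using assms(2) by blast
    then have "y = x [^] (k mod e)" using int_pow_mod assms by simp
    then show "y \<in> (\<lambda>k. x [^] k) ` {0..<e}" using assms(4) by simp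
  qed
  then have "card (carrier G) \<le> card {0..<e}"
    by (meson card_image_le card_mono finite_atLeastLessThan_int finite_imageI order_trans)
  then show ?thesis using assms(4) by (simp add: order_def)
qed

lemma (in group) cyclic_groupE:
  assumes "cyclic_group G"
  obtains g where "g \<in> carrier G" "\<And>x. x \<in> carrier G \<Longrightarrow> \<exists>k::int. x = g [^] k"
  using assms by (force simp: cyclic_group)

lemma (in group) cyclic_groupI:
  assumes "g \<in> carrier G" "\<And>x. x \<in> carrier G \<Longrightarrow> \<exists>k::int. x = g [^] k"
  shows "cyclic_group G"
proof -
  have "carrier G \<subseteq> range (\<lambda>k::int. g [^] k)" using assms(2) by blast
  then have "carrier G = range (\<lambda>k::int. g [^] k)" using assms(1) by blast
  then show ?thesis unfolding cyclic_group using assms(1) by blast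
qed

lemma (in group) central_element_of_order_3:
  assumes "order G = 3 ^ n" "n > 0"
  obtains w where "w \<in> carrier G" "\<And>x. x \<in> carrier G \<Longrightarrow> x \<otimes> w = w \<otimes> x"
    "\<And>k::int. w [^] k = \<one> \<longleftrightarrow> 3 dvd k"
proof -
  have "carrier G \<noteq> {\<one>}"
    using assms one_less_power[of "3::nat" n] by (auto simp: order_def)
  then obtain z where z: "z \<in> carrier G" "z \<noteq> \<one>" "\<And>x. x \<in> carrier G \<Longrightarrow> x \<otimes> z = z \<otimes> x"
    using normal_subgroup_meets_center[of 3 n "carrier G"] assms(1)
      normal_invI[OF subgroup_self] by auto
  have "ord z dvd 3 ^ n" using ord_dvd_group_order[OF z(1)] assms by simp
  then obtain i where i: "ord z = 3 ^ i" "i \<le> n"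
    using divides_primepow_nat[of 3] by auto
  have "i \<noteq> 0" using i z ord_eq_1[OF z(1)] by (metis power_0)
  then obtain j where j: "i = Suc j" by (cases i) auto
  define w where "w = z [^] ((3::int) ^ j)"
  show ?thesis
  proof (rule that[of w])
    show "w \<in> carrier G" using z by (simp add: w_def)
    show "x \<otimes> w = w \<otimes> x" if "x \<in> carrier G" for x
      unfolding w_def using int_pow_commute[of z x] z that by simp
    show "w [^] k = \<one> \<longleftrightarrow> 3 dvd k" for k :: int
      using z i j by (simp add: w_def int_pow_pow int_pow_eq_id mult.commute[of 3])
  qed
qed

lemma twisted_plane_3I:
  fixes G (structure)
  assumes "group G" "w \<in> carrier G" "u \<in> carrier G"
    and w_central: "\<And>x. x \<in> carrier G \<Longrightarrow> x \<otimes> w = w \<otimes> x"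
    and w_pow: "\<And>k::int. w [^] k = \<one> \<longleftrightarrow> 3 dvd k"
    and u3: "u [^] (3::int) = \<one>" and "\<And>k::int. u \<noteq> w [^] k"
    and "\<And>x. x \<in> carrier G \<Longrightarrow> \<exists>k::int. x \<otimes> u = w [^] k \<otimes> u \<otimes> x"
  shows "twisted_plane G 3 w u"
  using assms by (simp add: twisted_plane_def twisted_plane_axioms_def)

text \<open>Let W = <w> and H = G/W. By \<open>suffices\<close> it is enough to find an element of
  cube 1 whose image in H is central and nontrivial. If H is cyclic, then G is abelian and a power
  of a generator lift works. Otherwise take a plane P of H: cubing is a homomorphism from the
  preimage of P to W, and since P has rank 2 some v over a nontrivial element of P has cube 1.
  Either the image of v is central, or a commutator of v with some x does the job.\<close>

lemma twisted_plane_exists_step: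
  fixes G :: "('a, 'm) monoid_scheme" (structure)
  assumes G: "group G" and ord: "order G = 3 ^ n" and noncyc: "\<not> cyclic_group G"
    and IH: "\<And>H :: nat monoid. group H \<Longrightarrow> order H = 3 ^ (n - 1) \<Longrightarrow> n > 0 \<Longrightarrow> \<not> cyclic_group H \<Longrightarrow>
      \<exists>w u. twisted_plane H 3 w u"
  shows "\<exists>w u. twisted_plane G 3 w u"
proof -
  interpret group G by fact
  have "card (carrier G) > 0" using ord by (simp add: order_def)
  then have fin: "finite (carrier G)" by (rule card_ge_0_finite)
  have n: "n > 0"
  proof (rule ccontr)
    assume "\<not> n > 0"
    then have "order G = 1" using ord by simp
    then have "carrier G = {\<one>}" using fin by (metis order_one_triv_iff)
    then show False using noncyc cyclic_groupI[of \<one>] by auto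
  qed
  obtain w where w: "w \<in> carrier G" "\<And>x. x \<in> carrier G \<Longrightarrow> x \<otimes> w = w \<otimes> x"
    "\<And>k::int. w [^] k = \<one> \<longleftrightarrow> 3 dvd k"
    using central_element_of_order_3[OF ord n] by blast
  define W where "W = range (\<lambda>k::int. w [^] k)"
  have w3: "w [^] (3::int) = \<one>" using w by simp
  have wc: "w [^] (k::int) \<otimes> x = x \<otimes> w [^] k" if "x \<in> carrier G" for x k
    using int_pow_commute[of w x k] w that by simp
  have subW: "subgroup W G"
    unfolding W_def
  proof
    show "\<one> \<in> range (\<lambda>k::int. w [^] k)" by (rule range_eqI[of _ _ 0]) simp
  qed (auto simp: w int_pow_mult[symmetric] int_pow_neg[symmetric])
  have W: "W \<lhd> G"
  proof (rule normal_invI[OF subW])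
    fix x h assume "x \<in> carrier G" "h \<in> W"
    then show "x \<otimes> h \<otimes> inv x \<in> W" by (auto simp: W_def wc[symmetric] m_assoc w)
  qed
  have "W = (\<lambda>k::int. w [^] k) ` {0..<3}"
  proof -
    have "w [^] k \<in> (\<lambda>k::int. w [^] k) ` {0..<3}" for k :: int
      using int_pow_mod[OF w(1) w3, of k] by (intro image_eqI[of _ _ "k mod 3"]) simp_all
    then show ?thesis by (auto simp: W_def)
  qed
  moreover have "inj_on (\<lambda>k::int. w [^] k) {0..<3}"
  proof (rule inj_onI)
    fix k l :: int assume kl: "k \<in> {0..<3}" "l \<in> {0..<3}" "w [^] k = w [^] l"
    then have "w [^] (k - l) = \<one>" using w by (simp add: int_pow_diff)
    then have "k mod 3 = l mod 3" by (simp only: w mod_eq_dvd_iff)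
    then show "k = l" using kl(1,2) by (metis atLeastLessThan_iff mod_pos_pos_trivial)
  qed
  ultimately have cardW: "card W = 3" by (simp add: card_image)
  obtain H :: "nat monoid" and \<pi> where H: "group H" "group_hom G H \<pi>" "\<pi> ` carrier G = carrier H"
    "kernel G H \<pi> = W" "order G = card W * order H"
    using quotient_on_nat[OF W fin] by blast
  interpret \<pi>: group_hom G H \<pi> by fact
  have "3 * order H = 3 ^ n" using H(5) ord unfolding cardW by metis
  then have ordH: "order H = 3 ^ (n - 1)" using n by (cases n) simp_all
  have ker: "\<pi> x = \<one>\<^bsub>H\<^esub> \<longleftrightarrow> (\<exists>k::int. x = w [^] k)" if "x \<in> carrier G" for x
  proof -
    have "\<pi> x = \<one>\<^bsub>H\<^esub> \<longleftrightarrow> x \<in> kernel G H \<pi>" using that by (simp add: kernel_def)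
    then show ?thesis unfolding H(4) W_def by blast
  qed
  have suffices: "\<exists>w u. twisted_plane G 3 w u"
    if u: "u \<in> carrier G" "u [^] (3::int) = \<one>" "\<pi> u \<noteq> \<one>\<^bsub>H\<^esub>"
      "\<And>x. x \<in> carrier G \<Longrightarrow> \<pi> x \<otimes>\<^bsub>H\<^esub> \<pi> u = \<pi> u \<otimes>\<^bsub>H\<^esub> \<pi> x" for u
  proof (intro exI, rule twisted_plane_3I[OF G w(1) u(1) w(2,3) u(2)])
    show "u \<noteq> w [^] k" for k :: int using u(1,3) ker by blast
    fix x assume x: "x \<in> carrier G"
    have "\<pi> (x \<otimes> u \<otimes> inv (u \<otimes> x)) = \<one>\<^bsub>H\<^esub>"
      using u(1,4) x by (simp del: inv_mult_group)
    then obtain k :: int where "x \<otimes> u \<otimes> inv (u \<otimes> x) = w [^] k"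
      using ker x u(1) by (metis inv_closed m_closed)
    then have "x \<otimes> u = w [^] k \<otimes> (u \<otimes> x)"
      using x u(1) w(1) by (metis inv_solve_right' int_pow_closed m_closed)
    then show "\<exists>k::int. x \<otimes> u = w [^] k \<otimes> u \<otimes> x" using x u(1) w(1) by (auto simp: m_assoc)
  qed
  have quot: "\<exists>k::int. y = x \<otimes> w [^] k" if xy: "x \<in> carrier G" "y \<in> carrier G" "\<pi> x = \<pi> y" for x y
  proof -
    have "\<pi> (inv x \<otimes> y) = \<one>\<^bsub>H\<^esub>" using xy by simp
    then obtain k :: int where "inv x \<otimes> y = w [^] k"
      using ker[of "inv x \<otimes> y"] xy(1,2) by auto
    then have "y = x \<otimes> w [^] k" using xy w(1) by (metis inv_solve_left int_pow_closed)
    then show ?thesis ..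
  qed
  show ?thesis
  proof (cases "cyclic_group H")
    case True
    then obtain h where h: "h \<in> carrier H" "\<And>x. x \<in> carrier H \<Longrightarrow> \<exists>k::int. x = h [^]\<^bsub>H\<^esub> k"
      using \<pi>.H.cyclic_groupE by blast
    from h(1) obtain g where g: "g \<in> carrier G" "\<pi> g = h"
      unfolding H(3)[symmetric] by (metis imageE)
    have gen: "\<exists>(j::int) (k::int). x = g [^] j \<otimes> w [^] k" if x: "x \<in> carrier G" for x
    proof -
      obtain j :: int where "\<pi> x = h [^]\<^bsub>H\<^esub> j" using h(2)[OF \<pi>.hom_closed[OF x]] by blast
      then have "\<pi> (g [^] j) = \<pi> x" using g \<pi>.hom_int_pow by simp
      from quot[OF int_pow_closed[OF g(1)] x this] show ?thesis by blast
    qed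
    have "h [^]\<^bsub>H\<^esub> order H = \<one>\<^bsub>H\<^esub>" using \<pi>.H.pow_order_eq_1 h by blast
    then have "\<pi> (g [^] order H) = \<one>\<^bsub>H\<^esub>" using g \<pi>.hom_nat_pow by simp
    then obtain l :: int where l: "g [^] order H = w [^] l" using ker g by blast
    \<comment> \<open>Otherwise w would be a power of g, and g would generate all of G.\<close>
    have "3 dvd l"
    proof (rule ccontr)
      assume "\<not> 3 dvd l"
      then have "\<exists>r::int. 3 dvd r * l - 1" using square_mod_3 by blast
      then obtain r q :: int where r: "r * l - 1 = 3 * q" by (auto simp: dvd_def)
      have "w [^] (r * l - 1) = \<one>" using r w by simp
      then have "w [^] (l * r) = w" using w(1) by (simp add: int_pow_diff mult.commute) (metis inv_solve_right' int_pow_closed l_one one_closed)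
      then have wg: "w = g [^] (int (order H) * r)"
        using l w(1) g(1) by (metis int_pow_int int_pow_pow)
      have "cyclic_group G"
      proof (rule cyclic_groupI[OF g(1)])
        fix x assume "x \<in> carrier G"
        then obtain j k :: int where "x = g [^] j \<otimes> w [^] k" using gen by blast
        then have "x = g [^] (j + int (order H) * r * k)"
          using g(1) wg by (simp add: int_pow_mult int_pow_pow)
        then show "\<exists>k::int. x = g [^] k" ..
      qed
      then show False using noncyc by simp
    qed
    then have g1: "g [^] order H = \<one>" using l w by simp
    have "n - 1 > 0"
    proof (rule ccontr)
      assume "\<not> n - 1 > 0"
      then have "g = \<one>" using g1 ordH g by simp
      then have "cyclic_group G" using cyclic_groupI[OF w(1)] gen w(1) by auto
      then show False using noncyc by simp
    qed
    then obtain i where i: "n - 1 = Suc i" by (cases "n - 1") auto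
    have oH: "int (order H) = 3 * 3 ^ i" unfolding ordH i by simp
    show ?thesis
    proof (rule suffices[of "g [^] ((3::int) ^ i)"])
      show "g [^] ((3::int) ^ i) \<in> carrier G" using g by simp
      have "(g [^] ((3::int) ^ i)) [^] (3::int) = g [^] int (order H)"
        using g by (simp add: int_pow_pow oH mult.commute)
      then show "(g [^] ((3::int) ^ i)) [^] (3::int) = \<one>" using g1 by (simp add: int_pow_int)
      show "\<pi> (g [^] ((3::int) ^ i)) \<noteq> \<one>\<^bsub>H\<^esub>"
      proof
        assume "\<pi> (g [^] ((3::int) ^ i)) = \<one>\<^bsub>H\<^esub>"
        then have "h [^]\<^bsub>H\<^esub> ((3::int) ^ i) = \<one>\<^bsub>H\<^esub>" using g \<pi>.hom_int_pow by simp
        from \<pi>.H.order_le_of_generator[OF h this] show False using oH by simp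
      qed
      fix x assume x: "x \<in> carrier G"
      obtain j :: int where "\<pi> x = h [^]\<^bsub>H\<^esub> j" using h(2)[OF \<pi>.hom_closed[OF x]] by blast
      then show "\<pi> x \<otimes>\<^bsub>H\<^esub> \<pi> (g [^] ((3::int) ^ i)) = \<pi> (g [^] ((3::int) ^ i)) \<otimes>\<^bsub>H\<^esub> \<pi> x"
        using g h by (simp add: \<pi>.hom_int_pow \<pi>.H.int_pow_mult[symmetric] add.commute)
    qed
  next
    case False
    obtain w' u' where "twisted_plane H 3 w' u'" using IH[OF H(1) ordH n False] by blast
    then interpret P: twisted_plane H 3 w' u' .
    have el: "\<exists>x\<in>carrier G. \<pi> x = P.el i j" for i j
      using P.el_closed[of i j] unfolding H(3)[symmetric] by (metis imageE)
    have cube: "\<exists>k::int. x [^] (3::int) = w [^] k" if "x \<in> carrier G" "\<pi> x = P.el i j" for x i j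
    proof -
      have "\<pi> (x [^] (3::int)) = P.el i j \<otimes>\<^bsub>H\<^esub> P.el i j \<otimes>\<^bsub>H\<^esub> P.el i j"
        using that by (simp add: int_pow_3)
      also have "\<dots> = \<one>\<^bsub>H\<^esub>" by (simp add: P.el_mult P.el_eq_one_iff)
      finally show ?thesis using ker that by simp
    qed
    \<comment> \<open>P is abelian, so commutators of elements lying over it fall into W, which is
      central of exponent 3.\<close>
    have cube_mult: "(x \<otimes> y) [^] (3::int) = x [^] (3::int) \<otimes> y [^] (3::int)"
      if xy: "x \<in> carrier G" "y \<in> carrier G" "\<pi> x = P.el i j" "\<pi> y = P.el k l" for x y i j k l
    proof -
      have "\<pi> (x \<otimes> y) = \<pi> (y \<otimes> x)" using xy by (simp add: P.el_mult add.commute)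
      then obtain q :: int where q: "y \<otimes> x = x \<otimes> y \<otimes> w [^] q" using quot xy by (metis m_closed)
      show ?thesis
      proof (rule pow3_mult_of_central_commutator[of x y "w [^] q"])
        show "y \<otimes> x = w [^] q \<otimes> (x \<otimes> y)" using q xy by (simp add: wc)
        show "(w [^] q) [^] (3::int) = \<one>" using w by (simp add: int_pow_pow)
      qed (use xy w wc in auto)
    qed
    obtain v i j where v: "v \<in> carrier G" "\<pi> v = P.el i j" "v [^] (3::int) = \<one>" "\<not> (3 dvd i \<and> 3 dvd j)"
    proof -
      obtain a b where ab: "a \<in> carrier G" "\<pi> a = P.el 1 0" "b \<in> carrier G" "\<pi> b = P.el 0 1"
        using el by blast
      obtain k l :: int where kl: "a [^] (3::int) = w [^] k" "b [^] (3::int) = w [^] l"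
        using cube ab by blast
      show ?thesis
      proof (cases "3 dvd k")
        case True
        then show ?thesis using that[of a 1 0] ab kl w by simp
      next
        case False
        \<comment> \<open>The cube of a^r b is w^(kr + l), and k is its own inverse modulo 3, so
          this r cancels the exponent.\<close>
        define r where "r = - (k * l)"
        have "k * r + l = - l * (k * k - 1)" by (simp add: r_def algebra_simps)
        then have r: "3 dvd k * r + l" using square_mod_3[OF False] by simp
        have ar: "\<pi> (a [^] r) = P.el r 0"
          using ab P.el_c by (simp add: \<pi>.hom_int_pow)
        have "(a [^] r \<otimes> b) [^] (3::int) = (a [^] r) [^] (3::int) \<otimes> b [^] (3::int)"
          by (rule cube_mult) (use ab ar in auto)
        also have "(a [^] r) [^] (3::int) = (a [^] (3::int)) [^] r"
          using ab by (simp add: int_pow_pow mult.commute)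
        also have "\<dots> \<otimes> b [^] (3::int) = w [^] (k * r + l)"
          using w kl by (simp add: int_pow_pow int_pow_mult)
        also have "\<dots> = \<one>" using w r by simp
        finally show ?thesis using that[of "a [^] r \<otimes> b" r 1] ab ar by (simp add: P.el_mult)
      qed
    qed
    have v1: "\<pi> v \<noteq> \<one>\<^bsub>H\<^esub>" using v P.el_eq_one_iff by simp
    show ?thesis
    proof (cases "\<forall>x\<in>carrier G. \<pi> x \<otimes>\<^bsub>H\<^esub> \<pi> v = \<pi> v \<otimes>\<^bsub>H\<^esub> \<pi> x")
      case True
      then show ?thesis using suffices[OF v(1) v(3) v1] by blast
    next
      case False
      then obtain x where x: "x \<in> carrier G" "\<pi> x \<otimes>\<^bsub>H\<^esub> \<pi> v \<noteq> \<pi> v \<otimes>\<^bsub>H\<^esub> \<pi> x" by blast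
      obtain p where p: "P.twist (\<pi> x) p" using P.twist_exists[of "\<pi> x"] x by auto
      \<comment> \<open>The commutator y v^-1 lies over a power of the central generator of P. Its
        cube is 1 because y and v^-1 have cube 1 and cubing is multiplicative over P.\<close>
      define y where "y = x \<otimes> v \<otimes> inv x"
      have y: "y \<in> carrier G" using x v by (simp add: y_def)
      have "\<pi> y = \<pi> x \<otimes>\<^bsub>H\<^esub> P.el i j \<otimes>\<^bsub>H\<^esub> inv\<^bsub>H\<^esub> \<pi> x" using x v by (simp add: y_def)
      also have "\<dots> = P.el (i + p * j) j" using P.twist_el[OF p] x by (simp add: \<pi>.H.m_assoc)
      finally have \<pi>y: "\<pi> y = P.el (i + p * j) j" .
      have iv: "\<pi> (inv v) = P.el (- i) (- j)" using v P.el_inv by simp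
      have "(y \<otimes> inv v) [^] (3::int) = y [^] (3::int) \<otimes> (inv v) [^] (3::int)"
        by (rule cube_mult[OF _ _ \<pi>y iv]) (use y v in auto)
      also have "(inv v) [^] (3::int) = \<one>" using v by (simp add: int_pow_inv)
      also have "y [^] (3::int) = \<one>" unfolding y_def using conj_int_pow[of x v 3] x v by simp
      finally have c: "(y \<otimes> inv v) [^] (3::int) = \<one>" by simp
      have e: "\<pi> (y \<otimes> inv v) = P.el (p * j) 0" using y v \<pi>y iv by (simp add: P.el_mult)
      show ?thesis
      proof (rule suffices[OF _ c])
        show "\<pi> (y \<otimes> inv v) \<noteq> \<one>\<^bsub>H\<^esub>"
        proof
          assume "\<pi> (y \<otimes> inv v) = \<one>\<^bsub>H\<^esub>"
          then have "3 dvd p * j" using e P.el_eq_one_iff by simp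
          then have "P.el (i + p * j) j = P.el i j" by (simp add: P.el_eq_iff)
          then have "\<pi> x \<otimes>\<^bsub>H\<^esub> \<pi> v = \<pi> v \<otimes>\<^bsub>H\<^esub> \<pi> x" using P.twist_el[OF p] x v by simp
          then show False using x by simp
        qed
        show "\<pi> z \<otimes>\<^bsub>H\<^esub> \<pi> (y \<otimes> inv v) = \<pi> (y \<otimes> inv v) \<otimes>\<^bsub>H\<^esub> \<pi> z" if "z \<in> carrier G" for z
          unfolding e P.el_c using P.c_commute[of "\<pi> z"] that by simp
      qed (use y v in simp)
    qed
  qed
qed

lemma twisted_plane_exists_nat:
  fixes G :: "nat monoid"
  shows "group G \<Longrightarrow> order G = 3 ^ n \<Longrightarrow> \<not> cyclic_group G \<Longrightarrow> \<exists>w u. twisted_plane G 3 w u"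
proof (induction n arbitrary: G)
  case 0
  then show ?case by (intro twisted_plane_exists_step[of G 0]) auto
next
  case (Suc n)
  then show ?case by (intro twisted_plane_exists_step[of G "Suc n"]) auto
qed

lemma twisted_plane_exists:
  assumes "group G" "order G = 3 ^ n" "\<not> cyclic_group G"
  shows "\<exists>w u. twisted_plane G 3 w u"
  using assms by (rule twisted_plane_exists_step) (rule twisted_plane_exists_nat)

section \<open>Groups of order 27 and products of a cyclic group with a group of order 3\<close>

definition triples :: "(int \<times> int \<times> int) list" where
  "triples = List.product [0..2] (List.product [0..2] [0..2])"

text \<open>The multiplication of the elements \<open>u\<^sup>i w\<^sup>j g\<^sup>k\<close>, where \<open>w\<close> is central of order 3,
  \<open>g u = w\<^sup>e u g\<close> and \<open>g\<^sup>3 = w\<^sup>f\<close>.\<close>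

fun triple_mult :: "int \<Rightarrow> int \<Rightarrow> int \<times> int \<times> int \<Rightarrow> int \<times> int \<times> int \<Rightarrow> int \<times> int \<times> int" where
  "triple_mult e f (i, j, k) (i', j', k') =
    ((i + i') mod 3, (j + j' + e * k * i' + f * ((k + k') div 3)) mod 3, (k + k') mod 3)"

fun triple_lookup :: "(int \<times> int \<times> int) list \<Rightarrow> int \<times> int \<times> int \<Rightarrow> int \<times> int \<times> int" where
  "triple_lookup t (i, j, k) = t ! nat (9 * i + 3 * j + k)"

text \<open>The quotient x^-1 z, found by search. That the search succeeds is not assumed:
  \<open>triple_colouring\<close> checks each result by multiplying back.\<close>

definition triple_ldiv :: "int \<Rightarrow> int \<Rightarrow> int \<times> int \<times> int \<Rightarrow> int \<times> int \<times> int \<Rightarrow> int \<times> int \<times> int" where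
  "triple_ldiv e f x z = the (find (\<lambda>y. triple_mult e f x y = z) triples)"

definition triple_colouring :: "int \<Rightarrow> int \<Rightarrow> (int \<times> int \<times> int) list \<Rightarrow> bool" where
  "triple_colouring e f t \<longleftrightarrow>
    (let s = triple_lookup t; d = \<lambda>x. triple_ldiv e f x (s x) in
      (\<forall>x\<in>set triples. s x \<in> set triples \<and> d x \<in> set triples \<and> triple_mult e f x (d x) = s x) \<and>
      distinct (map s triples) \<and> distinct (map d triples) \<and>
      distinct (map (\<lambda>x. triple_mult e f (s x) x) triples) \<and>
      distinct (map (\<lambda>x. triple_mult e f (d x) x) triples))"

text \<open>The tables list the images of the elements of \<^const>\<open>triples\<close> in order; they were found with
  a SAT solver.\<close>

lemma triple_colourings:
  "triple_colouring 0 0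
     [(0, 1, 0), (2, 2, 0), (0, 0, 0), (1, 1, 1), (1, 0, 2),
      (0, 1, 2), (2, 0, 2), (2, 2, 1), (1, 0, 0), (2, 1, 2),
      (0, 1, 1), (1, 2, 1), (0, 2, 1), (2, 0, 0), (0, 0, 2),
      (2, 1, 0), (1, 2, 0), (1, 1, 0), (1, 0, 1), (1, 2, 2),
      (0, 0, 1), (1, 1, 2), (2, 2, 2), (0, 2, 2), (0, 2, 0),
      (2, 1, 1), (2, 0, 1)]"
  "triple_colouring 1 0
     [(0, 0, 0), (2, 2, 1), (1, 2, 0), (0, 0, 2), (2, 1, 2),
      (0, 1, 1), (2, 1, 1), (1, 0, 0), (1, 2, 1), (1, 1, 0),
      (2, 0, 0), (0, 2, 1), (1, 0, 1), (0, 2, 0), (2, 1, 0),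
      (0, 2, 2), (1, 2, 2), (2, 0, 2), (2, 2, 0), (1, 1, 1),
      (0, 1, 0), (2, 2, 2), (0, 0, 1), (1, 0, 2), (2, 0, 1),
      (1, 1, 2), (0, 1, 2)]"
  "triple_colouring 1 1
     [(0, 2, 1), (1, 0, 0), (0, 0, 2), (2, 2, 2), (1, 0, 1),
      (0, 2, 0), (2, 1, 0), (1, 1, 2), (2, 1, 1), (0, 0, 1),
      (1, 1, 1), (0, 2, 2), (2, 0, 0), (1, 2, 0), (0, 1, 0),
      (2, 1, 2), (1, 0, 2), (2, 2, 1), (2, 2, 0), (1, 2, 1),
      (2, 0, 1), (0, 1, 1), (1, 2, 2), (0, 0, 0), (2, 0, 2),
      (1, 1, 0), (0, 1, 2)]"
  "triple_colouring 2 0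
     [(0, 0, 0), (1, 2, 1), (2, 2, 0), (0, 0, 2), (1, 1, 2),
      (0, 1, 1), (1, 1, 1), (2, 0, 0), (2, 2, 1), (1, 2, 0),
      (2, 1, 1), (0, 1, 0), (1, 2, 2), (0, 0, 1), (2, 0, 2),
      (1, 0, 1), (2, 1, 2), (0, 1, 2), (2, 1, 0), (1, 0, 0),
      (0, 2, 1), (2, 0, 1), (0, 2, 0), (1, 1, 0), (0, 2, 2),
      (2, 2, 2), (1, 0, 2)]"
  "triple_colouring 2 1
     [(0, 2, 1), (2, 0, 0), (0, 0, 2), (1, 2, 2), (2, 0, 1),
      (0, 2, 0), (1, 1, 0), (2, 1, 2), (1, 1, 1), (1, 2, 0),
      (2, 2, 1), (1, 0, 1), (0, 1, 1), (2, 2, 2), (0, 0, 0),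
      (1, 0, 2), (2, 1, 0), (0, 1, 2), (0, 0, 1), (2, 1, 1),
      (0, 2, 2), (1, 0, 0), (2, 2, 0), (0, 1, 0), (1, 1, 2),
      (2, 0, 2), (1, 2, 1)]"
  by code_simp+

lemma triple_colouring_exists:
  assumes "(e, f) \<in> {(0, 0), (1, 0), (2, 0), (1, 1), (2, 1)}"
  obtains t where "triple_colouring e f t"
  using assms triple_colourings by blast

text \<open>The labels (i, j, k) exhaust G, and there are 27 of them, so they name the elements
  uniquely. The listed pairs omit (0, 1), for which G is the product of cyclic groups of order 9 and
  3; that group is coloured by \<open>colourable_cyclic_times_3\<close>.\<close>

lemma colourable_order_27:
  fixes G (structure) and e f :: int
  assumes plane: "twisted_plane G 3 w u" and ord: "order G = 27"
    and g: "g \<in> carrier G" "twisted_plane.twist G 3 w u g e" "g [^] (3::int) = w [^] f"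
    and ef: "(e, f) \<in> {(0, 0), (1, 0), (2, 0), (1, 1), (2, 1)}"
    and gen: "\<And>x. x \<in> carrier G \<Longrightarrow> \<exists>n\<in>twisted_plane.plane G w u. \<exists>k::int. x = n \<otimes> g [^] k"
  shows "colourable G"
proof -
  interpret twisted_plane G 3 w u by (rule plane)
  obtain t where t: "triple_colouring e f t" using triple_colouring_exists[OF ef] .
  define E where "E = (\<lambda>(i, j, k). el j i \<otimes> g [^] (k::int))"
  let ?A = "set triples"
  have A: "?A = {0..2} \<times> {0..2} \<times> {0..2}" by (auto simp: triples_def)
  \<comment> \<open>Reducing the exponent of g modulo 3 produces a carry, which g^3 = w^f turns into
    a change of the exponent of w.\<close>
  have red: "el j i \<otimes> g [^] k = E (i mod 3, (j + f * (k div 3)) mod 3, k mod 3)" for i j k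
  proof -
    have "g [^] k = g [^] (3 * (k div 3)) \<otimes> g [^] (k mod 3)"
      using int_pow_mult[OF g(1), of "3 * (k div 3)" "k mod 3"] by simp
    also have "g [^] (3 * (k div 3)) = (g [^] (3::int)) [^] (k div 3)" using g(1) by (simp add: int_pow_pow)
    also have "\<dots> = el (f * (k div 3)) 0" unfolding g(3) by (simp add: int_pow_pow el_c)
    finally have "el j i \<otimes> g [^] k = el j i \<otimes> el (f * (k div 3)) 0 \<otimes> g [^] (k mod 3)"
      using g(1) by (simp add: m_assoc)
    also have "el j i \<otimes> el (f * (k div 3)) 0 = el ((j + f * (k div 3)) mod 3) (i mod 3)"
      by (simp add: el_mult el_eq_iff flip: mod_eq_dvd_iff)
    finally show ?thesis by (simp add: E_def)
  qed
  have E_closed: "E x \<in> carrier G" for x using g(1) by (cases x) (simp add: E_def)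
  have img: "E ` ?A = carrier G"
  proof (intro equalityI subsetI)
    fix x assume "x \<in> carrier G"
    then obtain n and k :: int where "n \<in> plane" and x: "x = n \<otimes> g [^] k" using gen by blast
    then obtain j i where "n = el j i" by (auto elim: planeE)
    then have "x = E (i mod 3, (j + f * (k div 3)) mod 3, k mod 3)" using x red by simp
    moreover have "(i mod 3, (j + f * (k div 3)) mod 3, k mod 3) \<in> ?A"
      unfolding A by (simp; presburger)
    ultimately show "x \<in> E ` ?A" by blast
  qed (use E_closed in auto)
  have "card ?A = 27" unfolding A by (simp add: card_cartesian_product)
  then have "inj_on E ?A"
    using img ord by (intro eq_card_imp_inj_on) (simp_all add: order_def)
  then have bij: "bij_betw E ?A (carrier G)" using img by (simp add: bij_betw_def)
  have tw: "twist (g [^] (k::int)) (e * k)" if "k \<in> {0..2}" for k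
  proof -
    have "twist \<one> 0" by (simp add: twist_def)
    moreover have "twist (g \<otimes> g) (e + e)" using twist_mult g by blast
    moreover have "g [^] (2::int) = g \<otimes> g" using int_pow_mult[OF g(1), of 1 1] g(1) by simp
    moreover have "k = 0 \<or> k = 1 \<or> k = 2" using that by auto
    ultimately show ?thesis using g by (auto simp: mult_2_right)
  qed
  have mult: "E x \<otimes> E y = E (triple_mult e f x y)" if "x \<in> ?A" "y \<in> ?A" for x y
  proof -
    obtain i j k i' j' k' where xy: "x = (i, j, k)" "y = (i', j', k')" by (cases x; cases y) auto
    then have "k \<in> {0..2}" using that by (simp add: A)
    have "E x \<otimes> E y = el j i \<otimes> (g [^] k \<otimes> el j' i') \<otimes> g [^] k'"
      using g(1) by (simp add: xy E_def m_assoc)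
    also have "\<dots> = (el j i \<otimes> el (j' + e * k * i') i') \<otimes> (g [^] k \<otimes> g [^] k')"
      using g(1) twist_el[OF tw[OF \<open>k \<in> _\<close>]] by (simp add: m_assoc)
    also have "\<dots> = el (j + (j' + e * k * i')) (i + i') \<otimes> g [^] (k + k')"
      using g(1) by (simp add: el_mult int_pow_mult)
    also have "\<dots> = E (triple_mult e f x y)" unfolding red by (simp add: xy add.assoc)
    finally show ?thesis .
  qed
  have mult_closed: "triple_mult e f x y \<in> ?A" for x y
    by (cases x; cases y) (simp add: A; presburger)
  show ?thesis
  proof (rule colourable_by_labels[OF _ bij mult])
    let ?s = "triple_lookup t"
    let ?d = "\<lambda>x. triple_ldiv e f x (?s x)"
    note T = t[unfolded triple_colouring_def Let_def]
    show "?s x \<in> ?A" "?d x \<in> ?A" "triple_mult e f x (?d x) = ?s x" if "x \<in> ?A" for x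
      using T that by blast+
    show "inj_on ?s ?A" "inj_on ?d ?A" "inj_on (\<lambda>x. triple_mult e f (?s x) x) ?A"
      "inj_on (\<lambda>x. triple_mult e f (?d x) x) ?A"
      using T by (simp_all add: distinct_map)
  qed (use mult_closed in simp_all)
qed

section \<open>Direct products of a cyclic 3-group with a group of order 3\<close>

lemma div_add_1_cases:
  assumes "(K::int) > 0" shows "(z + 1) div K = z div K \<or> (z + 1) div K = z div K + 1"
proof -
  have "z div K \<le> (z + 1) div K" using assms by (intro zdiv_mono1) auto
  moreover have "(z + 1) div K \<le> (z + 1 * K) div K" using assms by (intro zdiv_mono1) auto
  ultimately show ?thesis using assms by auto
qed

text \<open>
  On \<open>\<int>/3K \<times> \<int>/3\<close> with \<open>K > 1\<close> a power of 3, no endomorphism is a colouring.  The map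
  \<open>(x, i) \<mapsto> (3x + 4 balanced i, digit K x i)\<close> loses the leading ternary digit \<open>x div K\<close> of \<open>x\<close> in the
  first coordinate and records it in the second.  Adding or subtracting \<open>(x, i)\<close> makes the first
  coordinate \<open>4z\<close> or \<open>2z\<close>, with \<open>z = x + balanced i\<close> or \<open>z = x + 2 balanced i\<close>, and for given \<open>z\<close>
  the second coordinate then distinguishes the three values of \<open>i\<close>, as the leading digits of \<open>z\<close>
  and \<open>z + 1\<close> differ by 0 or 1.
\<close>

definition balanced :: "int \<Rightarrow> int" where
  "balanced i = (if i = 1 then - 1 else if i = 2 then 1 else 0)"

definition digit :: "int \<Rightarrow> int \<Rightarrow> int \<Rightarrow> int" where
  "digit K x i = (if i = 1 then (x - 1) div K else if i = 2 then (x + 2) div K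
    else - (x div K) - (x + 1) div K)"

text \<open>For fixed z let t and t' be the quotients of z and z + 1 by K. The digit for i = 0, 1, 2
  is -t - t', t, t' in the sum and -t - t', t', t in the difference. After adding or subtracting i,
  the three values are t, t + 1, t + 2 modulo 3 in some order, both for t' = t and for t' = t + 1;
  this explains the odd entry for i = 0. The factors 4 and 2 cancel because they are prime to
  M.\<close>

lemma digit_colouring:
  fixes K :: int
  assumes K: "K = 3 ^ k" and M: "M = 3 * K" and ij: "i \<in> {0, 1, 2}" "j \<in> {0, 1, 2}"
  shows "M dvd 3 * x + 4 * balanced i - (3 * y + 4 * balanced j) \<Longrightarrow>
      3 dvd digit K x i - digit K y j \<Longrightarrow> i = j \<and> M dvd x - y"
    and "M dvd 4 * x + 4 * balanced i - (4 * y + 4 * balanced j) \<Longrightarrow>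
      3 dvd (digit K x i + i) - (digit K y j + j) \<Longrightarrow> i = j \<and> M dvd x - y"
    and "M dvd 2 * x + 4 * balanced i - (2 * y + 4 * balanced j) \<Longrightarrow>
      3 dvd (digit K x i - i) - (digit K y j - j) \<Longrightarrow> i = j \<and> M dvd x - y"
proof -
  have Kpos: "K > 0" by (simp add: K)
  have shift: "(z + K * q) div K = z div K + q" for z q using Kpos by simp
  \<comment> \<open>Shifting by Kq adds q to the digit when i is 1 or 2, and -2q when i = 0, which
    is again q modulo 3.\<close>
  have F_shift: "3 dvd digit K (z + K * q) l - digit K z l - q" for z q l
  proof -
    have "(z + K * q + 1) div K = (z + 1) div K + q" "(z + K * q - 1) div K = (z - 1) div K + q"
      "(z + K * q + 2) div K = (z + 2) div K + q"
      using shift[of "z + 1" q] shift[of "z - 1" q] shift[of "z + 2" q] by (simp_all add: algebra_simps)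
    then show ?thesis using Kpos by (auto simp: digit_def)
  qed
  have F_per: "3 dvd digit K z l - digit K z' l" if d: "M dvd z - z'" for z z' l
  proof -
    from d obtain q where "z - z' = M * q" by (elim dvdE)
    then have "z = z' + K * (3 * q)" by (simp add: M algebra_simps)
    then show ?thesis using F_shift[of z' "3 * q" l] by (auto simp: dvd_def) presburger
  qed
  have cop: "coprime M c" if "c = 2 \<or> c = 4" for c
  proof -
    have "coprime (3::int) 4" using coprime_add_one_right[of "3::int"] by simp
    then have "coprime (3 ^ Suc k) c" using that by (auto intro: coprime_power_left_iff[THEN iffD2])
    then show ?thesis by (simp add: M K)
  qed
  show "i = j \<and> M dvd x - y"
    if 1: "M dvd 3 * x + 4 * balanced i - (3 * y + 4 * balanced j)" and 2: "3 dvd digit K x i - digit K y j"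
  proof -
    have "3 dvd 3 * x + 4 * balanced i - (3 * y + 4 * balanced j)" using 1 by (rule dvd_trans[rotated]) (simp add: M)
    then have "3 dvd balanced i - balanced j" by presburger
    then have e: "i = j" using ij by (auto simp: balanced_def)
    then have "3 * K dvd 3 * (x - y)" using 1 by (simp add: M algebra_simps)
    then have "K dvd x - y" by (metis dvd_times_left_cancel_iff zero_neq_numeral)
    then obtain q where q: "x - y = K * q" by (elim dvdE)
    then have x: "x = y + K * q" by simp
    have "3 dvd q" using F_shift[of y q i] 2 unfolding e x by presburger
    then show ?thesis using q e by (auto simp: M)
  qed
  show "i = j \<and> M dvd x - y"
    if 1: "M dvd 4 * x + 4 * balanced i - (4 * y + 4 * balanced j)" and 2: "3 dvd (digit K x i + i) - (digit K y j + j)"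
  proof -
    define z where "z = x + balanced i"
    have "M dvd 4 * (z - (y + balanced j))" using 1 by (simp add: z_def algebra_simps)
    then have d: "M dvd z - (y + balanced j)" using cop[of 4] coprime_dvd_mult_right_iff by blast
    then have "M dvd (z - balanced j) - y" by (simp add: algebra_simps)
    then have "3 dvd digit K (z - balanced j) j - digit K y j" by (rule F_per)
    then have h: "3 dvd (digit K (z - balanced i) i + i) - (digit K (z - balanced j) j + j)"
      using 2 by (simp add: z_def) presburger
    define t t' where "t = z div K" and "t' = (z + 1) div K"
    have v: "digit K (z - balanced 0) 0 = - t - t'" "digit K (z - balanced 1) 1 = t"
      "digit K (z - balanced 2) 2 = t'"
      by (simp_all add: digit_def balanced_def t_def t'_def add.commute)
    have tt: "t' = t \<or> t' = t + 1"
      unfolding t_def t'_def by (rule div_add_1_cases[OF Kpos])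
    have "i = j" using ij tt h
      by (elim insertE disjE emptyE) (simp_all only: v simp_thms numeral_eq_iff, presburger+)
    then show ?thesis using d by (simp add: z_def)
  qed
  show "i = j \<and> M dvd x - y"
    if 1: "M dvd 2 * x + 4 * balanced i - (2 * y + 4 * balanced j)" and 2: "3 dvd (digit K x i - i) - (digit K y j - j)"
  proof -
    define z where "z = x + 2 * balanced i"
    have "M dvd 2 * (z - (y + 2 * balanced j))" using 1 by (simp add: z_def algebra_simps)
    then have d: "M dvd z - (y + 2 * balanced j)" using cop[of 2] coprime_dvd_mult_right_iff by blast
    then have "M dvd (z - 2 * balanced j) - y" by (simp add: algebra_simps)
    then have "3 dvd digit K (z - 2 * balanced j) j - digit K y j" by (rule F_per)
    then have h: "3 dvd (digit K (z - 2 * balanced i) i - i) - (digit K (z - 2 * balanced j) j - j)"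
      using 2 by (simp add: z_def) presburger
    define t t' where "t = z div K" and "t' = (z + 1) div K"
    have v: "digit K (z - 2 * balanced 0) 0 = - t - t'" "digit K (z - 2 * balanced 1) 1 = t'"
      "digit K (z - 2 * balanced 2) 2 = t"
      by (simp_all add: digit_def balanced_def t_def t'_def add.commute)
    have tt: "t' = t \<or> t' = t + 1"
      unfolding t_def t'_def by (rule div_add_1_cases[OF Kpos])
    have "i = j" using ij tt h
      by (elim insertE disjE emptyE) (simp_all only: v simp_thms numeral_eq_iff, presburger+)
    then show ?thesis using d by (simp add: z_def)
  qed
qed

lemma (in group) colourable_cyclic_times_3:
  assumes gu: "g \<in> carrier G" "u \<in> carrier G" "g \<otimes> u = u \<otimes> g"
    and pow: "g [^] ((3::int) ^ Suc k) = \<one>" "u [^] (3::int) = \<one>"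
    and gen: "\<And>x. x \<in> carrier G \<Longrightarrow> \<exists>(a::int) (i::int). x = g [^] a \<otimes> u [^] i"
    and ord: "order G = 3 ^ Suc (Suc k)"
  shows "colourable G"
proof -
  define K :: int where "K = 3 ^ k"
  define M where "M = 3 * K"
  define A where "A = {0..<M} \<times> {0..<3::int}"
  define E where "E = (\<lambda>(a, i). g [^] (a::int) \<otimes> u [^] (i::int))"
  define r where "r = (\<lambda>(a, i). (a mod M, i mod (3::int)))"
  note dc = digit_colouring[OF K_def M_def]
  have M: "M > 0" "M = 3 ^ Suc k" by (simp_all add: M_def K_def)
  have rA: "r z \<in> A" for z using M(1) by (cases z) (simp add: r_def A_def)
  have Er: "E (r z) = E z" for z
    using int_pow_mod[OF gu(1) pow(1)] int_pow_mod[OF gu(2) pow(2)]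
    by (cases z) (simp add: E_def r_def M(2))
  have img: "E ` A = carrier G"
  proof (intro equalityI subsetI)
    fix x assume "x \<in> carrier G"
    then obtain a i :: int where "x = g [^] a \<otimes> u [^] i" using gen by blast
    then have "x = E (a, i)" by (simp add: E_def)
    then show "x \<in> E ` A" using Er rA by (metis image_eqI)
  qed (use gu in \<open>auto simp: E_def\<close>)
  have "card A = 3 ^ Suc (Suc k)"
    by (simp add: A_def M(2) card_cartesian_product nat_mult_distrib nat_power_eq)
  then have "inj_on E A"
    using img ord by (intro eq_card_imp_inj_on) (simp_all add: order_def A_def)
  then have bij: "bij_betw E A (carrier G)" using img by (simp add: bij_betw_def)
  have comm: "u [^] i \<otimes> g [^] a = g [^] a \<otimes> u [^] i" for i a :: int
    using int_pow_commute[OF gu(2) int_pow_closed[OF gu(1)]] int_pow_commute[OF gu] gu(2) by metis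
  have EE: "E (a, i) \<otimes> E (b, j) = E (a + b, i + j)" for a i b j
  proof -
    have "E (a, i) \<otimes> E (b, j) = g [^] a \<otimes> (u [^] i \<otimes> g [^] b) \<otimes> u [^] j"
      using gu by (simp add: E_def m_assoc)
    also have "\<dots> = E (a + b, i + j)"
      unfolding comm using gu by (simp add: E_def m_assoc int_pow_mult)
    finally show ?thesis .
  qed
  define mul where "mul = (\<lambda>(a, i) (b, j). r (a + b, i + j))"
  define S where "S = (\<lambda>(a, i). r (3 * a + 4 * balanced i, digit K a i))"
  define D where "D = (\<lambda>(a, i). r (2 * a + 4 * balanced i, digit K a i - i))"
  have inj: "inj_on (\<lambda>(a, i). r (f a i, h a i)) A"
    if "\<And>a i b j. i \<in> {0, 1, 2} \<Longrightarrow> j \<in> {0, 1, 2} \<Longrightarrow> M dvd f a i - f b j \<Longrightarrow> 3 dvd h a i - h b j \<Longrightarrow>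
      i = j \<and> M dvd a - b" for f h
  proof (rule inj_onI, clarify)
    fix a i b j assume ab: "(a, i) \<in> A" "(b, j) \<in> A" "r (f a i, h a i) = r (f b j, h b j)"
    then have "M dvd f a i - f b j" "3 dvd h a i - h b j"
      by (simp_all add: r_def mod_eq_dvd_iff)
    moreover have "i \<in> {0, 1, 2}" "j \<in> {0, 1, 2}" using ab by (auto simp: A_def)
    ultimately have "i = j" "M dvd a - b" using that by blast+
    then have "a mod M = b mod M" by (simp only: mod_eq_dvd_iff)
    then show "a = b \<and> i = j" using ab \<open>i = j\<close> by (simp add: A_def)
  qed
  show ?thesis
  proof (rule colourable_by_labels[OF _ bij, where mul = mul and S = S and D = D])
    show "finite A" by (simp add: A_def)
    show "E x \<otimes> E y = E (mul x y)" for x y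
      by (cases x; cases y) (simp add: mul_def Er EE)
    show "mul x y \<in> A" for x y using rA by (cases x; cases y) (simp add: mul_def)
    show "S x \<in> A" "D x \<in> A" for x using rA by (cases x; simp add: S_def D_def)+
    show "mul x (D x) = S x" for x
      by (cases x) (simp add: mul_def D_def S_def r_def mod_simps algebra_simps)
    show "inj_on S A" unfolding S_def by (rule inj) (rule dc(1))
    show "inj_on D A" unfolding D_def by (rule inj) (rule dc(3))
    have "(\<lambda>x. mul (S x) x) = (\<lambda>(a, i). r (4 * a + 4 * balanced i, digit K a i + i))"
      by (auto simp: mul_def S_def r_def mod_simps algebra_simps fun_eq_iff)
    then show "inj_on (\<lambda>x. mul (S x) x) A" using inj[OF dc(2)] by simp
    \<comment> \<open>The group is abelian, so x^-1 sigma(x) x is sigma(x).\<close>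
    have "(\<lambda>x. mul (D x) x) = S"
      by (auto simp: mul_def S_def D_def r_def mod_simps algebra_simps fun_eq_iff)
    then show "inj_on (\<lambda>x. mul (D x) x) A" using inj[OF dc(1)] by (simp add: S_def)
  qed
qed

section \<open>The groups \<open>L\<^sub>r\<close>\<close>

text \<open>The relations of L_r together with the normal form a^i b^j and the full order 3^r.
  Stated inside G, it can be tested on quotients and contradicted by counting;
  \<open>modular_type_imp_iso_L\<close> turns it into an isomorphism with
  \<open>L r\<close>.\<close>

definition modular_type :: "('a, 'm) monoid_scheme \<Rightarrow> nat \<Rightarrow> bool" where
  "modular_type G r \<longleftrightarrow> (\<exists>a\<in>carrier G. \<exists>b\<in>carrier G.
    a [^]\<^bsub>G\<^esub> ((3::int) ^ (r - 1)) = \<one>\<^bsub>G\<^esub> \<and> b [^]\<^bsub>G\<^esub> (3::int) = \<one>\<^bsub>G\<^esub> \<and>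
    b \<otimes>\<^bsub>G\<^esub> a \<otimes>\<^bsub>G\<^esub> inv\<^bsub>G\<^esub> b = a [^]\<^bsub>G\<^esub> ((1::int) + 3 ^ (r - 2)) \<and>
    (\<forall>x\<in>carrier G. \<exists>(i::int) (j::int). x = a [^]\<^bsub>G\<^esub> i \<otimes>\<^bsub>G\<^esub> b [^]\<^bsub>G\<^esub> j) \<and>
    order G = 3 ^ r)"

context group
begin

definition word_value :: "('g \<Rightarrow> 'a) \<Rightarrow> 'g word \<Rightarrow> 'a" where
  "word_value f w = foldr (\<lambda>(x, s) y. (if s then f x else inv (f x)) \<otimes> y) w \<one>"

lemma word_value_closed [simp]: "(\<And>x. f x \<in> carrier G) \<Longrightarrow> word_value f w \<in> carrier G"
  by (induction w) (auto simp: word_value_def)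

lemma word_value_append:
  assumes "\<And>x. f x \<in> carrier G"
  shows "word_value f (u @ v) = word_value f u \<otimes> word_value f v"
proof (induction u)
  case Nil
  then show ?case using word_value_closed[of f v, OF assms] by (simp add: word_value_def)
next
  case (Cons a u)
  obtain x s where a: "a = (x, s)" by force
  have "word_value f (a # w) = (if s then f x else inv (f x)) \<otimes> word_value f w" for w
    by (simp add: a word_value_def)
  moreover have "(if s then f x else inv (f x)) \<in> carrier G" using assms by auto
  ultimately show ?case using Cons assms by (simp add: m_assoc)
qed

lemma word_value_gen_pow:
  assumes "\<And>x. f x \<in> carrier G"
  shows "word_value f (gen_pow x n) = f x [^] n"
proof (induction n)
  case (Suc n)
  have "gen_pow x (Suc n) = gen_pow x n @ [(x, True)]"
    by (simp add: gen_pow_def replicate_append_same)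
  moreover have "f x \<in> carrier G" using assms by auto
  ultimately show ?case using Suc by (simp add: word_value_append[OF assms]) (simp add: word_value_def)
qed (simp add: gen_pow_def word_value_def)

text \<open>Von Dyck's theorem: evaluation of words respects the congruence as soon as it respects
  the relations.\<close>

lemma word_value_cong:
  assumes f: "\<And>x. f x \<in> carrier G" and R: "\<And>l r. (l, r) \<in> R \<Longrightarrow> word_value f l = word_value f r"
    and "word_eq R u v"
  shows "word_value f u = word_value f v"
  using assms(3)
proof (induction rule: word_eq.induct)
  case (cancel u x s v)
  have "word_value f [(x, s), (x, \<not> s)] = \<one>"
    using f by (auto simp: word_value_def)
  then have "word_value f (u @ [(x, s), (x, \<not> s)] @ v) = word_value f u \<otimes> (\<one> \<otimes> word_value f v)"
    by (simp only: word_value_append[OF f])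
  then show ?case using f by (simp add: word_value_append)
qed (simp_all add: word_value_append[OF f] R)

end

lemma word_class_in_carrier: "word_class R u \<in> carrier (presented_group R)"
  by (simp add: presented_group_def)

lemma one_presented_group: "\<one>\<^bsub>presented_group R\<^esub> = word_class R []"
  by (simp add: presented_group_def)

lemma carrier_presented_groupE:
  assumes "A \<in> carrier (presented_group R)" obtains u where "A = word_class R u"
  using assms by (auto simp: presented_group_def)

lemma word_class_Cons:
  "word_class R ((x, s) # w) = (if s then word_class R [(x, True)]
    else inv\<^bsub>presented_group R\<^esub> (word_class R [(x, True)])) \<otimes>\<^bsub>presented_group R\<^esub> word_class R w"
proof -
  interpret P: group "presented_group R" by (rule group_presented_group)
  have "word_class R [(x, False)] \<otimes>\<^bsub>presented_group R\<^esub> word_class R [(x, True)] = \<one>\<^bsub>presented_group R\<^esub>"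
    unfolding mult_word_class one_presented_group word_class_eq_iff
    using word_eq.cancel[of R "[]" x False "[]"] by simp
  then have "inv\<^bsub>presented_group R\<^esub> (word_class R [(x, True)]) = word_class R [(x, False)]"
    using word_class_in_carrier by (intro P.inv_equality) auto
  then show ?thesis by (simp add: mult_word_class)
qed

lemma word_class_gen_pow:
  "word_class R (gen_pow x n) = word_class R [(x, True)] [^]\<^bsub>presented_group R\<^esub> n"
proof (induction n)
  case (Suc n)
  have "gen_pow x (Suc n) = gen_pow x n @ [(x, True)]"
    by (simp add: gen_pow_def replicate_append_same)
  then show ?case using Suc by (simp add: mult_word_class[symmetric])
qed (simp add: gen_pow_def one_presented_group)

text \<open>The set \<open>T\<close> of products a^i b^j contains 1 and is stable under left
  multiplication by every letter: the conjugation relation moves b past a power of a, and the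
  inverse of b is b b. So it is everything, and reducing exponents leaves at most 3^(r-1) * 3
  elements.\<close>

lemma L_facts:
  fixes r :: nat
  defines "R \<equiv> {(gen_pow Gen_a (3 ^ (r - 1)), []), (gen_pow Gen_b 3, []),
      ([(Gen_b, True), (Gen_a, True), (Gen_b, False)], gen_pow Gen_a (1 + 3 ^ (r - 2)))}"
  assumes r: "r \<ge> 2"
  shows "L r = presented_group R" and "finite (carrier (L r))" and "card (carrier (L r)) \<le> 3 ^ r"
proof -
  show LR: "L r = presented_group R" by (simp add: L_def R_def)
  define P where "P = presented_group R"
  interpret P: group P unfolding P_def by (rule group_presented_group)
  define a where "a = word_class R [(Gen_a, True)]"
  define b where "b = word_class R [(Gen_b, True)]"
  have [simp]: "a \<in> carrier P" "b \<in> carrier P"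
    by (simp_all add: a_def b_def P_def word_class_in_carrier)
  have rel: "word_class R l = word_class R l'" if "(l, l') \<in> R" for l l'
    using word_eq.relation[OF that, of "[]" "[]"] by (simp add: word_class_eq_iff)
  have a_pow: "a [^]\<^bsub>P\<^esub> ((3::int) ^ (r - 1)) = \<one>\<^bsub>P\<^esub>"
    using rel[of "gen_pow Gen_a (3 ^ (r - 1))" "[]"]
    by (simp add: R_def word_class_gen_pow a_def P_def one_presented_group flip: int_pow_int)
  have b_pow: "b [^]\<^bsub>P\<^esub> (3::int) = \<one>\<^bsub>P\<^esub>"
    using rel[of "gen_pow Gen_b 3" "[]"]
    by (simp add: R_def word_class_gen_pow b_def P_def one_presented_group flip: int_pow_int)
  define q where "q = (1::int) + 3 ^ (r - 2)"
  have bab: "b \<otimes>\<^bsub>P\<^esub> a \<otimes>\<^bsub>P\<^esub> inv\<^bsub>P\<^esub> b = a [^]\<^bsub>P\<^esub> q"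
  proof -
    have "word_class R [(Gen_b, True), (Gen_a, True), (Gen_b, False)]
        = word_class R (gen_pow Gen_a (1 + 3 ^ (r - 2)))"
      by (rule rel) (simp add: R_def)
    also have "word_class R [(Gen_b, True), (Gen_a, True), (Gen_b, False)] = b \<otimes>\<^bsub>P\<^esub> (a \<otimes>\<^bsub>P\<^esub> (inv\<^bsub>P\<^esub> b \<otimes>\<^bsub>P\<^esub> \<one>\<^bsub>P\<^esub>))"
      using word_class_Cons[of R Gen_b True "[(Gen_a, True), (Gen_b, False)]"]
        word_class_Cons[of R Gen_a True "[(Gen_b, False)]"] word_class_Cons[of R Gen_b False "[]"]
      by (simp add: a_def b_def P_def one_presented_group)
    also have "word_class R (gen_pow Gen_a (1 + 3 ^ (r - 2))) = a [^]\<^bsub>P\<^esub> q"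
      unfolding word_class_gen_pow a_def[symmetric] P_def[symmetric] q_def
      by (metis int_pow_int of_nat_1 of_nat_add of_nat_numeral of_nat_power)
    finally show ?thesis by (simp add: P.m_assoc)
  qed
  define T where "T = {a [^]\<^bsub>P\<^esub> i \<otimes>\<^bsub>P\<^esub> b [^]\<^bsub>P\<^esub> j | (i::int) (j::int). True}"
  have aT: "a [^]\<^bsub>P\<^esub> k \<otimes>\<^bsub>P\<^esub> x \<in> T" if "x \<in> T" for x and k :: int
  proof -
    obtain i j :: int where "x = a [^]\<^bsub>P\<^esub> i \<otimes>\<^bsub>P\<^esub> b [^]\<^bsub>P\<^esub> j" using \<open>x \<in> T\<close> by (auto simp: T_def)
    then have "a [^]\<^bsub>P\<^esub> k \<otimes>\<^bsub>P\<^esub> x = a [^]\<^bsub>P\<^esub> (k + i) \<otimes>\<^bsub>P\<^esub> b [^]\<^bsub>P\<^esub> j"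
      by (simp add: P.int_pow_mult P.m_assoc)
    then show ?thesis by (auto simp: T_def)
  qed
  have bT: "b \<otimes>\<^bsub>P\<^esub> x \<in> T" if "x \<in> T" for x
  proof -
    obtain i j :: int where x: "x = a [^]\<^bsub>P\<^esub> i \<otimes>\<^bsub>P\<^esub> b [^]\<^bsub>P\<^esub> j" using \<open>x \<in> T\<close> by (auto simp: T_def)
    have "b \<otimes>\<^bsub>P\<^esub> x = (b \<otimes>\<^bsub>P\<^esub> a [^]\<^bsub>P\<^esub> i \<otimes>\<^bsub>P\<^esub> inv\<^bsub>P\<^esub> b) \<otimes>\<^bsub>P\<^esub> (b \<otimes>\<^bsub>P\<^esub> b [^]\<^bsub>P\<^esub> j)"
    proof -
      have "inv\<^bsub>P\<^esub> b \<otimes>\<^bsub>P\<^esub> (b \<otimes>\<^bsub>P\<^esub> b [^]\<^bsub>P\<^esub> j) = b [^]\<^bsub>P\<^esub> j"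
        by (simp flip: P.m_assoc)
      then show ?thesis unfolding x by (simp add: P.m_assoc)
    qed
    also have "\<dots> = a [^]\<^bsub>P\<^esub> (q * i) \<otimes>\<^bsub>P\<^esub> b [^]\<^bsub>P\<^esub> (1 + j)"
      using P.int_pow_mult[of b 1 j] by (simp add: P.conj_int_pow bab P.int_pow_pow)
    finally show ?thesis by (auto simp: T_def)
  qed
  have "inv\<^bsub>P\<^esub> a = a [^]\<^bsub>P\<^esub> (-1::int)" by (simp add: P.int_pow_neg)
  moreover have "inv\<^bsub>P\<^esub> b = b \<otimes>\<^bsub>P\<^esub> b"
    using b_pow by (intro P.inv_equality) (simp_all add: P.int_pow_3)
  ultimately have T: "word_class R w \<in> T" for w
  proof (induction w)
    case Nil
    have "\<one>\<^bsub>P\<^esub> = a [^]\<^bsub>P\<^esub> (0::int) \<otimes>\<^bsub>P\<^esub> b [^]\<^bsub>P\<^esub> (0::int)" by simp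
    then show ?case unfolding T_def P_def one_presented_group by blast
  next
    case (Cons l w)
    obtain x s where l: "l = (x, s)" by force
    have "word_class R w \<in> T" using Cons by blast
    moreover have "word_class R w \<in> carrier P" by (simp add: P_def word_class_in_carrier)
    ultimately show ?case
      unfolding l word_class_Cons[of R x s w] P_def[symmetric]
      using aT[of _ 1] aT[of _ "-1"] bT Cons.prems
      by (cases x; cases s) (simp_all add: P.m_assoc flip: a_def b_def)
  qed
  let ?I = "{0..<(3::int) ^ (r - 1)} \<times> {0..<3::int}"
  have "carrier P \<subseteq> (\<lambda>(i, j). a [^]\<^bsub>P\<^esub> i \<otimes>\<^bsub>P\<^esub> b [^]\<^bsub>P\<^esub> j) ` ?I"
  proof
    fix x assume "x \<in> carrier P"
    then obtain w where "x = word_class R w" unfolding P_def by (rule carrier_presented_groupE)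
    then obtain i j :: int where "x = a [^]\<^bsub>P\<^esub> i \<otimes>\<^bsub>P\<^esub> b [^]\<^bsub>P\<^esub> j" using T[of w] by (auto simp: T_def)
    then have "x = a [^]\<^bsub>P\<^esub> (i mod 3 ^ (r - 1)) \<otimes>\<^bsub>P\<^esub> b [^]\<^bsub>P\<^esub> (j mod 3)"
      using P.int_pow_mod[OF _ a_pow] P.int_pow_mod[OF _ b_pow] by simp
    then show "x \<in> (\<lambda>(i, j). a [^]\<^bsub>P\<^esub> i \<otimes>\<^bsub>P\<^esub> b [^]\<^bsub>P\<^esub> j) ` ?I"
      by (intro image_eqI[of _ _ "(i mod 3 ^ (r - 1), j mod 3)"]) simp_all
  qed
  then have sub: "carrier P \<subseteq> (\<lambda>(i, j). a [^]\<^bsub>P\<^esub> i \<otimes>\<^bsub>P\<^esub> b [^]\<^bsub>P\<^esub> j) ` ?I" .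
  have "finite ?I" by simp
  moreover have "card ?I = 3 ^ r"
    using r by (cases r) (simp_all add: card_cartesian_product nat_power_eq)
  ultimately show "finite (carrier (L r))" "card (carrier (L r)) \<le> 3 ^ r"
    unfolding LR P_def[symmetric]
    using finite_subset[OF sub finite_imageI] surj_card_le[OF _ sub] by simp_all
qed

text \<open>Evaluation gives a homomorphism from \<open>L r\<close> onto G. As \<open>L r\<close>
  has at most 3^r elements and G has exactly that many, it is injective.\<close>

lemma modular_type_imp_iso_L:
  fixes G (structure)
  assumes "group G" "r \<ge> 2" "modular_type G r"
  shows "G \<cong> L r"
proof -
  interpret group G by fact
  obtain a b where ab: "a \<in> carrier G" "b \<in> carrier G"
    and rels: "a [^] ((3::int) ^ (r - 1)) = \<one>" "b [^] (3::int) = \<one>"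
      "b \<otimes> a \<otimes> inv b = a [^] ((1::int) + 3 ^ (r - 2))"
    and gen: "\<And>x. x \<in> carrier G \<Longrightarrow> \<exists>(i::int) (j::int). x = a [^] i \<otimes> b [^] j"
    and ord: "order G = 3 ^ r"
    using assms(3) unfolding modular_type_def by blast
  define R where "R = {(gen_pow Gen_a (3 ^ (r - 1)), []), (gen_pow Gen_b 3, []),
      ([(Gen_b, True), (Gen_a, True), (Gen_b, False)], gen_pow Gen_a (1 + 3 ^ (r - 2)))}"
  note LR = L_facts[OF assms(2), folded R_def]
  interpret P: group "L r" unfolding LR(1) by (rule group_presented_group)
  define f where "f x = (case x of Gen_a \<Rightarrow> a | Gen_b \<Rightarrow> b)" for x
  have f: "f x \<in> carrier G" for x using ab by (simp add: f_def split: generator.splits)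
  have pw: "x [^] (n::nat) = x [^] int n" for x n by (simp add: int_pow_int)
  have cong: "word_value f l = word_value f l'" if "(l, l') \<in> R" for l l'
  proof -
    have "word_value f [(Gen_b, True), (Gen_a, True), (Gen_b, False)] = b \<otimes> a \<otimes> inv b"
      using ab by (simp add: word_value_def f_def m_assoc)
    moreover have "word_value f [] = \<one>" by (simp add: word_value_def)
    moreover have "word_value f (gen_pow Gen_a (3 ^ (r - 1))) = \<one>"
      using rels(1) by (simp add: word_value_gen_pow[OF f] pw f_def)
    moreover have "word_value f (gen_pow Gen_b 3) = \<one>"
      using rels(2) by (simp add: word_value_gen_pow[OF f] pw f_def)
    moreover have "word_value f (gen_pow Gen_a (1 + 3 ^ (r - 2))) = b \<otimes> a \<otimes> inv b"
      unfolding word_value_gen_pow[OF f] pw rels(3) by (simp add: f_def)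
    ultimately show ?thesis using that unfolding R_def by auto
  qed
  define \<phi> where "\<phi> A = word_value f (SOME u. u \<in> A)" for A
  have \<phi>: "\<phi> (word_class R u) = word_value f u" for u
  proof -
    have "u \<in> word_class R u" by (simp add: word_class_def word_eq.refl)
    then have "word_eq R u (SOME v. v \<in> word_class R u)"
      by (metis mem_Collect_eq someI word_class_def)
    then show ?thesis unfolding \<phi>_def using word_value_cong[OF f cong] by metis
  qed
  have hom: "\<phi> \<in> hom (L r) G"
    unfolding LR(1)
    by (rule homI) (auto elim!: carrier_presented_groupE simp: \<phi> f mult_word_class word_value_append)
  then interpret \<phi>: group_hom "L r" G \<phi>
    by (simp add: group_hom_def group_hom_axioms_def P.is_group is_group)
  have surj: "\<phi> ` carrier (L r) = carrier G"
  proof (intro equalityI subsetI)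
    fix x assume "x \<in> carrier G"
    then obtain i j :: int where x: "x = a [^] i \<otimes> b [^] j" using gen by blast
    define A where "A = word_class R [(Gen_a, True)]"
    define B where "B = word_class R [(Gen_b, True)]"
    have "A \<in> carrier (L r)" "B \<in> carrier (L r)"
      by (simp_all add: A_def B_def LR(1) word_class_in_carrier)
    moreover have "\<phi> A = a" "\<phi> B = b"
      using ab by (simp_all add: A_def B_def \<phi> word_value_def f_def)
    ultimately have "\<phi> (A [^]\<^bsub>L r\<^esub> i \<otimes>\<^bsub>L r\<^esub> B [^]\<^bsub>L r\<^esub> j) = x"
      "A [^]\<^bsub>L r\<^esub> i \<otimes>\<^bsub>L r\<^esub> B [^]\<^bsub>L r\<^esub> j \<in> carrier (L r)"
      by (simp_all add: x \<phi>.hom_int_pow)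
    then show "x \<in> \<phi> ` carrier (L r)" by blast
  qed auto
  have "inj_on \<phi> (carrier (L r))"
  proof (rule eq_card_imp_inj_on[OF LR(2)])
    have "card (carrier (L r)) \<le> card (\<phi> ` carrier (L r))"
      using LR(3) ord surj by (simp add: order_def)
    then show "card (\<phi> ` carrier (L r)) = card (carrier (L r))"
      using card_image_le[OF LR(2), of \<phi>] by simp
  qed
  then have "\<phi> \<in> iso (L r) G" using hom surj by (simp add: iso_def bij_betw_def)
  then have "L r \<cong> G" by (auto simp: is_iso_def)
  then show ?thesis by (rule P.iso_sym)
qed

section \<open>The induction\<close>

lemma (in group) order_le_of_two_generators:
  assumes "a \<in> carrier G" "b \<in> carrier G" "a [^] (p::int) = \<one>" "b [^] (q::int) = \<one>" "p > 0" "q > 0"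
    and gen: "\<And>x. x \<in> carrier G \<Longrightarrow> \<exists>(i::int) (j::int). x = a [^] i \<otimes> b [^] j"
  shows "int (order G) \<le> p * q"
proof -
  let ?I = "{0..<p} \<times> {0..<q}"
  have "carrier G \<subseteq> (\<lambda>(i, j). a [^] i \<otimes> b [^] j) ` ?I"
  proof
    fix x assume "x \<in> carrier G"
    then obtain i j :: int where "x = a [^] i \<otimes> b [^] j" using gen by blast
    then have "x = a [^] (i mod p) \<otimes> b [^] (j mod q)"
      using int_pow_mod assms(1-4) by simp
    then show "x \<in> (\<lambda>(i, j). a [^] i \<otimes> b [^] j) ` ?I"
      using assms(5,6) by (intro image_eqI[of _ _ "(i mod p, j mod q)"]) simp_all
  qed
  then have "card (carrier G) \<le> card ?I" by (rule surj_card_le[rotated]) simp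
  also have "card ?I = nat (p * q)"
    using assms(5,6) by (simp add: card_cartesian_product nat_mult_distrib)
  finally show ?thesis using assms(5,6) by (simp add: order_def le_nat_iff)
qed

lemma (in group) not_cyclic_if_small_exponent:
  assumes "order G = 3 ^ Suc e" "\<And>x. x \<in> carrier G \<Longrightarrow> x [^] ((3::int) ^ e) = \<one>"
  shows "\<not> cyclic_group G"
proof
  assume "cyclic_group G"
  then obtain g where "g \<in> carrier G" "\<And>x. x \<in> carrier G \<Longrightarrow> \<exists>k::int. x = g [^] k"
    using cyclic_groupE by blast
  then have "int (order G) \<le> 3 ^ e" using assms(2) by (intro order_le_of_generator) auto
  then show False using assms(1) by simp
qed

text \<open>Commutativity collapses the conjugation relation to a^(3^(r-2)) = 1, and the normal form
  then yields at most 3^(r-1) elements.\<close>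

lemma (in group) not_modular_type_if_commutative:
  assumes comm: "\<And>x y. x \<in> carrier G \<Longrightarrow> y \<in> carrier G \<Longrightarrow> x \<otimes> y = y \<otimes> x" and r: "r \<ge> 2"
  shows "\<not> modular_type G r"
proof
  assume "modular_type G r"
  then obtain a b where ab: "a \<in> carrier G" "b \<in> carrier G"
    and rels: "b [^] (3::int) = \<one>" "b \<otimes> a \<otimes> inv b = a [^] ((1::int) + 3 ^ (r - 2))"
    and gen: "\<And>x. x \<in> carrier G \<Longrightarrow> \<exists>(i::int) (j::int). x = a [^] i \<otimes> b [^] j"
    and ord: "order G = 3 ^ r"
    unfolding modular_type_def by blast
  have "b \<otimes> a \<otimes> inv b = a" using comm[of b a] ab by (simp add: m_assoc)
  then have "a [^] ((3::int) ^ (r - 2)) = \<one>" using rels(2) ab by (simp add: int_pow_mult)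
  then have "int (order G) \<le> 3 ^ (r - 2) * 3"
    using order_le_of_two_generators[OF ab _ rels(1) _ _ gen] by simp
  moreover obtain s where "r = Suc (Suc s)" using r by (metis add_2_eq_Suc le_Suc_ex)
  ultimately show False using ord by simp
qed

section \<open>Planes with an abelian noncyclic quotient\<close>

text \<open>Ranges over all smaller exponents at once, because dividing by a plane lowers the
  exponent by 2 or by 3 according to the order of c.\<close>

definition smaller_colourable :: "nat \<Rightarrow> bool" where
  "smaller_colourable n \<longleftrightarrow> (\<forall>k<n. \<forall>H :: nat monoid. group H \<longrightarrow> order H = 3 ^ k \<longrightarrow>
    \<not> cyclic_group H \<longrightarrow> (\<forall>r\<ge>4. \<not> modular_type H r) \<longrightarrow> colourable H)"

lemma (in group) commute_mult:
  assumes "z \<in> carrier G" "a \<in> carrier G" "b \<in> carrier G" "a \<otimes> z = z \<otimes> a" "b \<otimes> z = z \<otimes> b"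
  shows "a \<otimes> b \<otimes> z = z \<otimes> (a \<otimes> b)"
  using assms by (metis m_assoc)

lemma (in group) commute_product:
  assumes "z \<in> carrier G" "a \<in> carrier G" "b \<in> carrier G" "d \<in> carrier G"
    and "a \<otimes> z = z \<otimes> a" "b \<otimes> z = z \<otimes> b" "d \<otimes> z = z \<otimes> d"
  shows "a [^] (i::int) \<otimes> b [^] (j::int) \<otimes> d [^] (l::int) \<otimes> z = z \<otimes> (a [^] i \<otimes> b [^] j \<otimes> d [^] l)"
  using assms by (intro commute_mult int_pow_commute) auto

lemma (in twisted_plane) el_pow: "el x i [^] (k::int) = el (x * k) (i * k)"
  unfolding el_def by (subst int_pow_mult_distrib) (simp_all add: c_commute int_pow_pow)

text \<open>The quotient by the plane has order 3^(e+1) and is generated by three commuting elements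
  killed by 3^e, so it is noncyclic; being abelian it is not of modular type, and the induction
  hypothesis applies. Two-generator quotients are handled with one generator equal to 1.\<close>

lemma (in twisted_plane) colourable_if_abelian_quotient:
  assumes IH: "smaller_colourable n" and ord: "order G = 3 ^ n"
    and e: "int (order G) = 3 * m * 3 ^ Suc e"
    and abd: "a \<in> carrier G" "b \<in> carrier G" "d \<in> carrier G"
    and gen: "\<And>x. x \<in> carrier G \<Longrightarrow>
      \<exists>(i::int) (j::int) (l::int). \<exists>n\<in>plane. x = a [^] i \<otimes> b [^] j \<otimes> d [^] l \<otimes> n"
    and comm: "\<exists>n\<in>plane. b \<otimes> a = a \<otimes> n \<otimes> b" "\<exists>n\<in>plane. d \<otimes> a = a \<otimes> n \<otimes> d"
      "\<exists>n\<in>plane. d \<otimes> b = b \<otimes> n \<otimes> d"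
    and exponent: "a [^] ((3::int) ^ e) \<in> plane" "b [^] ((3::int) ^ e) \<in> plane"
      "d [^] ((3::int) ^ e) \<in> plane"
  shows "colourable G"
proof -
  have "card (carrier G) > 0" using ord by (simp add: order_def)
  then have fin: "finite (carrier G)" by (rule card_ge_0_finite)
  obtain H :: "nat monoid" and \<pi> where H: "group H" "group_hom G H \<pi>" "\<pi> ` carrier G = carrier H"
    "kernel G H \<pi> = plane" "order G = card plane * order H"
    using quotient_on_nat[OF normal_plane fin] by blast
  interpret \<pi>: group_hom G H \<pi> by fact
  have "3 * m * int (order H) = 3 * m * 3 ^ Suc e"
    using e card_plane H(5) by (metis of_nat_mult)
  then have "int (order H) = 3 ^ Suc e" using m_pos by simp
  then have ordH: "order H = 3 ^ Suc e" by (metis of_nat_eq_iff of_nat_numeral of_nat_power)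
  have "Suc e < n"
  proof -
    have "(3::int) ^ Suc e < 3 ^ n" using e ord m_pos by (simp add: mult.commute) 
    then show ?thesis by (metis one_less_numeral_iff power_less_imp_less_exp semiring_norm(77))
  qed
  have ker: "\<pi> n = \<one>\<^bsub>H\<^esub>" "n \<in> carrier G" if "n \<in> plane" for n
    using that H(4) by (auto simp: kernel_def)
  have c1: "\<pi> y \<otimes>\<^bsub>H\<^esub> \<pi> x = \<pi> x \<otimes>\<^bsub>H\<^esub> \<pi> y"
    if "\<exists>n\<in>plane. y \<otimes> x = x \<otimes> n \<otimes> y" "x \<in> carrier G" "y \<in> carrier G" for x y
  proof -
    from that(1) obtain n where n: "n \<in> plane" "y \<otimes> x = x \<otimes> n \<otimes> y" by blast
    have "\<pi> y \<otimes>\<^bsub>H\<^esub> \<pi> x = \<pi> (x \<otimes> n \<otimes> y)" using that(2,3) by (simp flip: n(2))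
    then show ?thesis using that(2,3) ker[OF n(1)] by simp
  qed
  have comm': "\<pi> b \<otimes>\<^bsub>H\<^esub> \<pi> a = \<pi> a \<otimes>\<^bsub>H\<^esub> \<pi> b" "\<pi> d \<otimes>\<^bsub>H\<^esub> \<pi> a = \<pi> a \<otimes>\<^bsub>H\<^esub> \<pi> d"
    "\<pi> d \<otimes>\<^bsub>H\<^esub> \<pi> b = \<pi> b \<otimes>\<^bsub>H\<^esub> \<pi> d"
    using c1 comm abd by blast+
  have cl: "\<pi> a \<in> carrier H" "\<pi> b \<in> carrier H" "\<pi> d \<in> carrier H" using abd by auto
  have genH: "\<exists>(i::int) (j::int) (l::int). y = \<pi> a [^]\<^bsub>H\<^esub> i \<otimes>\<^bsub>H\<^esub> \<pi> b [^]\<^bsub>H\<^esub> j \<otimes>\<^bsub>H\<^esub> \<pi> d [^]\<^bsub>H\<^esub> l"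
    if y: "y \<in> carrier H" for y
  proof -
    from y obtain x where x: "x \<in> carrier G" "y = \<pi> x" unfolding H(3)[symmetric] by (metis imageE)
    from gen[OF x(1)] obtain i j l :: int and n where
      "n \<in> plane" "x = a [^] i \<otimes> b [^] j \<otimes> d [^] l \<otimes> n" by blast
    then have "y = \<pi> a [^]\<^bsub>H\<^esub> i \<otimes>\<^bsub>H\<^esub> \<pi> b [^]\<^bsub>H\<^esub> j \<otimes>\<^bsub>H\<^esub> \<pi> d [^]\<^bsub>H\<^esub> l"
      using abd x(2) ker by (simp add: \<pi>.hom_int_pow)
    then show ?thesis by blast
  qed
  have central: "x \<otimes>\<^bsub>H\<^esub> z = z \<otimes>\<^bsub>H\<^esub> x"
    if x: "x \<in> carrier H" and z: "z \<in> carrier H" "\<pi> a \<otimes>\<^bsub>H\<^esub> z = z \<otimes>\<^bsub>H\<^esub> \<pi> a"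
      "\<pi> b \<otimes>\<^bsub>H\<^esub> z = z \<otimes>\<^bsub>H\<^esub> \<pi> b" "\<pi> d \<otimes>\<^bsub>H\<^esub> z = z \<otimes>\<^bsub>H\<^esub> \<pi> d" for x z
  proof -
    from genH[OF x] obtain i j l :: int where
      "x = \<pi> a [^]\<^bsub>H\<^esub> i \<otimes>\<^bsub>H\<^esub> \<pi> b [^]\<^bsub>H\<^esub> j \<otimes>\<^bsub>H\<^esub> \<pi> d [^]\<^bsub>H\<^esub> l" by blast
    then show ?thesis using \<pi>.H.commute_product[OF z(1) cl z(2-4)] by blast
  qed
  have commH: "x \<otimes>\<^bsub>H\<^esub> y = y \<otimes>\<^bsub>H\<^esub> x" if "x \<in> carrier H" "y \<in> carrier H" for x y
    by (rule central[OF that]; rule central[OF that(2), symmetric]) (use cl comm' in simp_all)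
  have expH: "x [^]\<^bsub>H\<^esub> ((3::int) ^ e) = \<one>\<^bsub>H\<^esub>" if x: "x \<in> carrier H" for x
  proof -
    from genH[OF x] obtain i j l :: int where
      xe: "x = \<pi> a [^]\<^bsub>H\<^esub> i \<otimes>\<^bsub>H\<^esub> \<pi> b [^]\<^bsub>H\<^esub> j \<otimes>\<^bsub>H\<^esub> \<pi> d [^]\<^bsub>H\<^esub> l" by blast
    have one: "(\<pi> y [^]\<^bsub>H\<^esub> k) [^]\<^bsub>H\<^esub> ((3::int) ^ e) = \<one>\<^bsub>H\<^esub>"
      if y: "y \<in> carrier G" "y [^] ((3::int) ^ e) \<in> plane" for y and k :: int
    proof -
      have "\<pi> y [^]\<^bsub>H\<^esub> ((3::int) ^ e) = \<one>\<^bsub>H\<^esub>"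
        using ker(1)[OF y(2)] y(1) by (simp add: \<pi>.hom_int_pow)
      moreover have "(\<pi> y [^]\<^bsub>H\<^esub> k) [^]\<^bsub>H\<^esub> ((3::int) ^ e) = (\<pi> y [^]\<^bsub>H\<^esub> ((3::int) ^ e)) [^]\<^bsub>H\<^esub> k"
        using y(1) by (simp add: \<pi>.H.int_pow_pow mult.commute)
      ultimately show ?thesis by simp
    qed
    show ?thesis unfolding xe
      using cl one[OF abd(1) exponent(1)] one[OF abd(2) exponent(2)] one[OF abd(3) exponent(3)]
      by (simp add: \<pi>.H.int_pow_mult_distrib commH)
  qed
  have "\<not> modular_type H r" if "r \<ge> 4" for r
    using \<pi>.H.not_modular_type_if_commutative[OF commH] that by simp
  moreover have "\<not> cyclic_group H" by (rule \<pi>.H.not_cyclic_if_small_exponent[OF ordH expH])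
  ultimately have "colourable H"
    using IH \<open>Suc e < n\<close> H(1) ordH unfolding smaller_colourable_def by blast
  then show ?thesis by (rule colourable_if_quotient[OF fin H(2-4)])
qed

section \<open>Planes of order 9: cubes and change of the central generator\<close>

locale order_3_plane = twisted_plane G "3::int" w u for G (structure) and w u
begin

lemma w3: "w [^] (3::int) = \<one>" using c_pow by simp

lemma w_closed [simp]: "w \<in> carrier G" by (rule c_closed)

lemma el_cube: "n \<in> plane \<Longrightarrow> n [^] (3::int) = \<one>"
  by (auto elim!: planeE simp: int_pow_3 el_mult el_eq_one_iff)

lemma plane_commute: "n \<in> plane \<Longrightarrow> n' \<in> plane \<Longrightarrow> n \<otimes> n' = n' \<otimes> n"
  by (auto elim!: planeE simp: el_mult add.commute)

lemma plane_closed: "n \<in> plane \<Longrightarrow> n \<in> carrier G"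
  by (auto elim!: planeE)

text \<open>If T is the action of x by conjugation on the plane, seen as F_3^2, then the factor
  beside x^3 is n under 1 + T + T^2. Modulo 3 this is (T - 1)^2, which vanishes because T is
  unipotent.\<close>

lemma cube_mult_plane:
  assumes x: "x \<in> carrier G" and n: "n \<in> plane"
  shows "(x \<otimes> n) [^] (3::int) = x [^] (3::int)"
proof -
  obtain p where p: "twist x p" using twist_exists[OF x] by blast
  obtain y i where n': "n = el y i" using n by (rule planeE)
  note tw = twist_el'[OF p x]
  have "(x \<otimes> n) [^] (3::int) = x \<otimes> (el y i \<otimes> x) \<otimes> el y i \<otimes> x \<otimes> el y i"
    using x by (simp add: n' int_pow_3 m_assoc)
  also have "\<dots> = x \<otimes> x \<otimes> ((el (y - p * i) i \<otimes> el y i) \<otimes> x) \<otimes> el y i"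
    using x by (simp add: tw m_assoc)
  also have "\<dots> = x \<otimes> x \<otimes> x \<otimes> (el (y - p * i + y - p * (i + i)) (i + i) \<otimes> el y i)"
    unfolding el_mult tw using x by (simp add: m_assoc el_mult algebra_simps)
  also have "el (y - p * i + y - p * (i + i)) (i + i) \<otimes> el y i = \<one>"
    unfolding el_mult el_eq_one_iff by (simp add: algebra_simps)
  finally show ?thesis using x by (simp add: int_pow_3)
qed

text \<open>The cube of x has twist 3p, which is trivial modulo 3.\<close>

lemma cube_commutes:
  assumes x: "x \<in> carrier G" and n: "n \<in> plane"
  shows "x [^] (3::int) \<otimes> n = n \<otimes> x [^] (3::int)"
proof -
  obtain p where p: "twist x p" using twist_exists[OF x] by blast
  have "twist (x \<otimes> x \<otimes> x) (p + p + p)"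
    using twist_mult[OF twist_mult[OF p x p x] _ p x] x by simp
  then have t: "twist (x [^] (3::int)) (3 * p)" using x by (simp add: int_pow_3)
  obtain y i where n': "n = el y i" using n by (rule planeE)
  have "el (y + 3 * p * i) i = el y i" unfolding el_eq_iff by simp
  then show ?thesis using twist_el[OF t, of y i] x by (simp add: n')
qed

text \<open>If h is outside <w>, then w itself complements it and both are central. If h = w^x, then
  u stays, and its twists are rescaled by x, the inverse of x modulo 3.\<close>

lemma change_center:
  assumes h: "h \<in> plane" "h \<noteq> \<one>" "\<And>x. x \<in> carrier G \<Longrightarrow> x \<otimes> h = h \<otimes> x"
  obtains u' where "order_3_plane G h u'" "twisted_plane.plane G h u' = plane"
proof -
  obtain x i where hx: "h = el x i" using h(1) by (rule planeE)
  have hc: "h \<in> carrier G" using hx by simp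
  have hk: "h [^] k = el (x * k) (i * k)" for k :: int
    unfolding hx by (rule el_pow)
  have ni: "\<not> (3 dvd x \<and> 3 dvd i)" using h(2) el_eq_one_iff hx by blast
  have "Factorial_Ring.prime (3::int)" by simp
  then have dvd3: "3 dvd a * b \<longleftrightarrow> 3 dvd a \<or> 3 dvd b" for a b :: int by (rule prime_dvd_mult_iff)
  have pow: "h [^] k = \<one> \<longleftrightarrow> 3 dvd k" for k :: int
    unfolding hk el_eq_one_iff using ni dvd3 by blast
  have "\<exists>u'. u' \<in> plane \<and> (\<forall>k::int. u' \<noteq> h [^] k) \<and>
    (\<forall>t\<in>carrier G. \<exists>k::int. t \<otimes> u' = h [^] k \<otimes> u' \<otimes> t)"
  proof (cases "3 dvd i")
    case False
    have "w \<noteq> h [^] k" for k :: int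
    proof
      assume "w = h [^] k"
      then have "el 1 0 = el (x * k) (i * k)" using hk by (simp add: el_c)
      then have "3 dvd 1 - x * k" "3 dvd i * k" unfolding el_eq_iff by simp_all
      then have "3 dvd (1 - x * k) + x * k" using False dvd3 by (intro dvd_add dvd_mult) auto
      then show False by simp
    qed
    moreover have "t \<otimes> w = h [^] (0::int) \<otimes> w \<otimes> t" if "t \<in> carrier G" for t
      using that central by simp
    moreover have "w \<in> plane" using el_in_plane[of 1 0] by (simp add: el_c)
    ultimately show ?thesis by blast
  next
    case True
    have "u \<noteq> h [^] k" for k :: int
    proof
      assume "u = h [^] k"
      then have "el 0 1 = el (x * k) (i * k)" using hk by (simp add: el_u)
      then have "3 dvd 1 - i * k" unfolding el_eq_iff by simp
      then have "3 dvd (1 - i * k) + i * k" using True by (intro dvd_add dvd_mult2) auto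
      then show False by simp
    qed
    moreover have "\<exists>k::int. t \<otimes> u = h [^] k \<otimes> u \<otimes> t" if t: "t \<in> carrier G" for t
    proof -
      obtain p :: int where p: "t \<otimes> u = w [^] p \<otimes> u \<otimes> t" using conj[OF t] by auto
      have "x * (x * p) - p = (x * x - 1) * p" by (simp add: algebra_simps)
      then have "3 dvd x * (x * p) - p" using square_mod_3[of x] ni True by simp
      then have "h [^] (x * p) = w [^] p"
        unfolding hk el_c[symmetric] el_eq_iff using True by simp
      then show ?thesis using p by metis
    qed
    moreover have "u \<in> plane" using el_in_plane[of 0 1] by (simp add: el_u)
    ultimately show ?thesis by blast
  qed
  then obtain u' where u': "u' \<in> plane" "\<And>k::int. u' \<noteq> h [^] k"
    "\<And>t. t \<in> carrier G \<Longrightarrow> \<exists>k::int. t \<otimes> u' = h [^] k \<otimes> u' \<otimes> t" by blast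
  have tp: "twisted_plane G 3 h u'"
    by (rule twisted_plane_3I[OF is_group hc plane_closed[OF u'(1)] h(3) pow el_cube[OF u'(1)] u'(2,3)])
  interpret T: twisted_plane G 3 h u' by (rule tp)
  interpret P: subgroup plane G by (rule subgroup_plane)
  have "T.plane \<subseteq> plane"
  proof
    fix n assume "n \<in> T.plane"
    then obtain a b where "n = T.el a b" by (rule T.planeE)
    moreover have "h [^] a \<in> plane" unfolding hk by simp
    moreover have "u' [^] b \<in> plane"
    proof -
      obtain y j where "u' = el y j" using u'(1) by (rule planeE)
      then show ?thesis by (simp add: el_pow)
    qed
    ultimately show "n \<in> plane" unfolding T.el_def by simp
  qed
  moreover have "finite plane" "card T.plane = card plane"
    using card_plane T.card_plane by (auto intro: card_ge_0_finite)
  ultimately have "T.plane = plane" by (simp add: card_subset_eq)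
  then show ?thesis using that[OF order_3_plane.intro[OF tp]] by blast
qed

end

section \<open>Quotients that are cyclic or of modular type\<close>

context order_3_plane
begin

text \<open>Everything depends on h = g^(3^(k+1)), a central element of the plane. If h = 1, then
  either the order is 27 or the plane can be rotated to contain g^(3^k). If h is not 1, it becomes
  the central generator, and the twist q of g decides: q = 0 gives a direct product, q nonzero gives
  order 27 or the excluded modular type.\<close>

lemma colourable_if_cyclic_quotient:
  assumes IH: "smaller_colourable n" and ord: "order G = 3 ^ n" and n: "n = Suc (Suc (Suc k))"
    and nonmod: "\<And>r. r \<ge> 4 \<Longrightarrow> \<not> modular_type G r"
    and g: "g \<in> carrier G" "g [^] ((3::int) ^ Suc k) \<in> plane" "g [^] ((3::int) ^ k) \<notin> plane"
    and gen: "\<And>x. x \<in> carrier G \<Longrightarrow> \<exists>n\<in>plane. \<exists>j::int. x = n \<otimes> g [^] j"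
  shows "colourable G"
proof -
  define h where "h = g [^] ((3::int) ^ Suc k)"
  have gg: "g [^] (i::int) \<otimes> g [^] (j::int) = g [^] j \<otimes> g [^] i" for i j
    using g(1) by (simp add: int_pow_mult[symmetric] add.commute)
  have centralI: "x \<otimes> y = y \<otimes> x"
    if "x \<in> carrier G" "y \<in> carrier G" "g \<otimes> y = y \<otimes> g" "\<And>n. n \<in> plane \<Longrightarrow> n \<otimes> y = y \<otimes> n" for x y
  proof -
    from gen[OF that(1)] obtain n and j :: int where x: "n \<in> plane" "x = n \<otimes> g [^] j" by blast
    show ?thesis unfolding x(2)
      using that x(1) g(1) plane_closed by (intro commute_mult int_pow_commute) auto
  qed
  obtain p where p: "p \<in> {0, 1, 2}" "twist g p" using twist_exists[OF g(1)] by blast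
  show ?thesis
  proof (cases "h = \<one>")
    case h: True
    show ?thesis
    proof (cases k)
      case 0
      have "g [^] (3::int) = w [^] (0::int)" using h by (simp add: h_def 0)
      moreover have "order G = 27" using ord n 0 by simp
      ultimately show ?thesis
        using colourable_order_27[OF twisted_plane_axioms _ g(1) p(2)] p(1) gen by blast
    next
      case (Suc k')
      \<comment> \<open>Since k > 0, this is a cube, so it centralises the plane and hence G. In the
        quotient by <w, v> the images of g and u commute and are killed by 3^k, while the order is
        3^(k+1).\<close>
      define v where "v = g [^] ((3::int) ^ k)"
      have v: "v \<in> carrier G" using g(1) by (simp add: v_def)
      have v_cube: "v = (g [^] ((3::int) ^ k')) [^] (3::int)"
        using g(1) by (simp add: v_def int_pow_pow Suc mult.commute)
      have v3: "v [^] (3::int) = \<one>"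
        using h g(1) by (simp add: v_def h_def int_pow_pow mult.commute)
      have "g \<otimes> v = v \<otimes> g" unfolding v_def using gg[of 1] g(1) by simp
      moreover have "n \<otimes> v = v \<otimes> n" if "n \<in> plane" for n
        unfolding v_cube using cube_commutes[OF _ that] g(1) by simp
      ultimately have vc: "x \<otimes> v = v \<otimes> x" if "x \<in> carrier G" for x
        using centralI[OF that v] by blast
      have "v \<noteq> w [^] j" for j :: int
      proof
        assume "v = w [^] j"
        then have "v \<in> plane" using el_in_plane[of j 0] by (simp add: el_c)
        then show False using g(3) by (simp add: v_def)
      qed
      moreover have "x \<otimes> v = w [^] (0::int) \<otimes> v \<otimes> x" if "x \<in> carrier G" for x
        using vc[OF that] v by simp
      ultimately have "twisted_plane G 3 w v"
        using v3 central c_pow v by (intro twisted_plane_3I[OF is_group]) auto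
      then interpret V: twisted_plane G 3 w v .
      have wV: "w [^] j \<in> V.plane" for j :: int using V.el_in_plane[of j 0] by (simp add: V.el_c)
      have one: "\<one> \<in> V.plane" using V.el_in_plane[of 0 0] by (simp add: V.el_0)
      have u1: "u [^] ((3::int) ^ k) = \<one>"
        using el_eq_one_iff[of 0 "3 ^ k"] by (simp add: el_u Suc)
      show ?thesis
      proof (rule V.colourable_if_abelian_quotient[OF IH ord, of k g u \<one>])
        show "int (order G) = 3 * 3 * 3 ^ Suc k" using ord n by simp
        show "g \<in> carrier G" "u \<in> carrier G" "\<one> \<in> carrier G" using g by auto
        show "\<exists>n\<in>V.plane. u \<otimes> g = g \<otimes> n \<otimes> u"
        proof
          show "u \<otimes> g = g \<otimes> w [^] (- p) \<otimes> u"
            using twist_el'[OF p(2) g(1), of 0 1] g(1) by (simp add: el_def m_assoc)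
        qed (rule wV)
        show "\<exists>n\<in>V.plane. \<one> \<otimes> g = g \<otimes> n \<otimes> \<one>" "\<exists>n\<in>V.plane. \<one> \<otimes> u = u \<otimes> n \<otimes> \<one>"
          using one g(1) by (auto intro!: bexI[of _ \<one>])
        have "v \<in> V.plane" using V.el_in_plane[of 0 1] v by (simp add: V.el_u)
        then show "g [^] ((3::int) ^ k) \<in> V.plane" by (simp flip: v_def)
        show "u [^] ((3::int) ^ k) \<in> V.plane" "\<one> [^] ((3::int) ^ k) \<in> V.plane"
          using one u1 by simp_all
        fix x assume "x \<in> carrier G"
        then obtain n and j :: int where x: "n \<in> plane" "x = n \<otimes> g [^] j" using gen by blast
        then have "inv (g [^] j) \<otimes> n \<otimes> g [^] j \<in> plane"
          using normal.inv_op_closed1[OF normal_plane] g(1) by simp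
        then obtain y i where yi: "inv (g [^] j) \<otimes> n \<otimes> g [^] j = el y i" by (rule planeE)
        have "x = g [^] j \<otimes> (inv (g [^] j) \<otimes> n \<otimes> g [^] j)"
          using x g(1) plane_closed by (simp flip: m_assoc)
        also have "\<dots> = g [^] j \<otimes> u [^] i \<otimes> \<one> [^] (0::int) \<otimes> w [^] y"
          using g(1) c_commute[of "u [^] i" y] by (simp add: yi el_def m_assoc)
        finally show "\<exists>(i::int) (j::int) (l::int). \<exists>n\<in>V.plane. x = g [^] i \<otimes> u [^] j \<otimes> \<one> [^] l \<otimes> n"
          using wV by blast
      qed
    qed
  next
    case h: False
    have hp: "h \<in> plane" using g(2) by (simp add: h_def)
    have "g \<otimes> h = h \<otimes> g" unfolding h_def using gg[of 1] g(1) by simp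
    then have hc: "x \<otimes> h = h \<otimes> x" if "x \<in> carrier G" for x
      using centralI[OF that] plane_closed[OF hp] plane_commute[OF _ hp] by blast
    obtain u' where "order_3_plane G h u'" and plane': "twisted_plane.plane G h u' = plane"
      using change_center[OF hp h hc] .
    then interpret U: order_3_plane G h u' by simp
    obtain q where q: "q \<in> {0, 1, 2}" "U.twist g q" using U.twist_exists[OF g(1)] by blast
    have genU: "\<exists>(a::int) (i::int). x = U.el a i \<otimes> g [^] j" if "x = n \<otimes> g [^] j" "n \<in> plane" for x n j
      using that unfolding plane'[symmetric] by (auto elim: U.planeE)
    have hg: "h [^] y = g [^] ((3::int) ^ Suc k * y)" for y :: int
      using g(1) by (simp add: h_def int_pow_pow)
    have g_pow: "g [^] ((3::int) ^ Suc (Suc k)) = \<one>"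
      using U.w3 hg[of 3] by (simp add: mult.commute)
    consider "q = 0" | "q \<noteq> 0" "k = 0" | "q \<noteq> 0" "k > 0" by blast
    then show ?thesis
    proof cases
      case 1
      have gu: "g \<otimes> u' = u' \<otimes> g" using q(2) 1 by (simp add: U.twist_def)
      show ?thesis
      proof (rule colourable_cyclic_times_3[OF g(1) U.u_closed gu g_pow U.u3])
        show "order G = 3 ^ Suc (Suc (Suc k))" using ord n by simp
        fix x assume "x \<in> carrier G"
        then obtain n and j :: int where "n \<in> plane" "x = n \<otimes> g [^] j" using gen by blast
        then obtain a i :: int where "x = U.el a i \<otimes> g [^] j" using genU by blast
        also have "\<dots> = h [^] a \<otimes> (g [^] j \<otimes> u' [^] i)"
          using int_pow_commute[of u' "g [^] j" i] int_pow_commute[OF g(1) U.u_closed gu] g(1)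
          by (simp add: U.el_def m_assoc)
        also have "\<dots> = g [^] ((3::int) ^ Suc k * a + j) \<otimes> u' [^] i"
          using g(1) by (simp add: hg int_pow_mult m_assoc)
        finally show "\<exists>(a::int) (i::int). x = g [^] a \<otimes> u' [^] i" by blast
      qed
    next
      case 2
      have "g [^] (3::int) = h [^] (1::int)" using hg[of 1] 2 U.w_closed by (simp add: h_def)
      moreover have "order G = 27" using ord n 2 by simp
      ultimately show ?thesis
        using colourable_order_27[OF U.twisted_plane_axioms _ g(1) q(2)] q(1) 2 gen plane' by blast
    next
      case 3
      \<comment> \<open>Conjugation by u' multiplies g by h^(-q), so conjugation by b multiplies it
        by h^(q*q) = h, exactly as the relation of L_n demands.\<close>
      define b where "b = u' [^] (- q)"
      have b: "b \<in> carrier G" by (simp add: b_def)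
      have "modular_type G n"
        unfolding modular_type_def
      proof (intro bexI conjI ballI)
        show "g [^] ((3::int) ^ (n - 1)) = \<one>" using g_pow by (simp add: n)
        show "b [^] (3::int) = \<one>"
          using U.el_eq_one_iff[of 0 "- q * 3"] by (simp add: b_def int_pow_pow U.el_u)
        have qq: "3 dvd q * q - 1" using q(1) 3(1) by (intro square_mod_3) auto
        have "U.el 0 (- q) \<otimes> g = g \<otimes> U.el (q * q) (- q)"
          using U.twist_el'[OF q(2) g(1), of 0 "- q"] by simp
        also have "U.el (q * q) (- q) = U.el 1 (- q)" using qq by (simp add: U.el_eq_iff)
        finally have "b \<otimes> g = g \<otimes> h \<otimes> b"
          using g(1) U.w_closed by (simp add: U.el_def b_def m_assoc)
        then have "b \<otimes> g \<otimes> inv b = g \<otimes> h" using g(1) b U.w_closed by (simp add: m_assoc)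
        also have "\<dots> = g [^] ((1::int) + 3 ^ Suc k)" using g(1) by (simp add: int_pow_mult h_def)
        finally show "b \<otimes> g \<otimes> inv b = g [^] ((1::int) + 3 ^ (n - 2))" by (simp add: n)
        show "order G = 3 ^ n" by (rule ord)
        fix x assume "x \<in> carrier G"
        \<comment> \<open>The hypothesis \<open>gen\<close> puts the plane factor on the left,
          whereas the normal form wants g first; expanding the inverse of x and inverting again
          reverses the order.\<close>
        then have "inv x \<in> carrier G" by simp
        then obtain n' and j :: int where "n' \<in> plane" "inv x = n' \<otimes> g [^] j" using gen by blast
        then obtain a i :: int where x: "inv x = U.el a i \<otimes> g [^] j" using genU by blast
        have "x = inv (inv x)" using \<open>x \<in> carrier G\<close> by simp
        also have "\<dots> = g [^] (- j) \<otimes> U.el (- a) (- i)"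
          unfolding x using g(1) by (simp add: inv_mult_group U.el_inv int_pow_neg)
        also have "U.el (- a) (- i) = U.el (- a) (q * q * (- i))"
        proof -
          have "- i - q * q * (- i) = (q * q - 1) * i" by (simp add: algebra_simps)
          then show ?thesis using qq unfolding U.el_eq_iff by simp
        qed
        also have "\<dots> = h [^] (- a) \<otimes> b [^] (q * i)"
          by (simp add: U.el_def b_def int_pow_pow algebra_simps)
        also have "g [^] (- j) \<otimes> (h [^] (- a) \<otimes> b [^] (q * i)) = g [^] (- j + 3 ^ Suc k * (- a)) \<otimes> b [^] (q * i)"
          unfolding hg int_pow_mult[OF g(1)] using g(1) b by (simp only: m_assoc int_pow_closed)
        finally show "\<exists>(i::int) (j::int). x = g [^] i \<otimes> b [^] j" by blast
      qed (use g b in auto)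
      then show ?thesis using nonmod[of n] 3 n by simp
    qed
  qed
qed

text \<open>The only obstruction to an abelian quotient is the commutator of b and a, which is c n0
  up to the plane, with c = a^(3^(r-2)). Once c is known to be central, it can be absorbed: if c^3 =
  1 by a plane of order 9 replacing u, otherwise by the plane <c, u> of order 27.\<close>

lemma colourable_if_modular_quotient:
  assumes IH: "smaller_colourable n" and ord: "order G = 3 ^ n" and n: "n = r + 2" and r: "r \<ge> 4"
    and ab: "a \<in> carrier G" "b \<in> carrier G"
    and a_pow: "a [^] ((3::int) ^ (r - 1)) \<in> plane" and c_notin: "a [^] ((3::int) ^ (r - 2)) \<notin> plane"
    and b_pow: "b [^] (3::int) \<in> plane"
    and conj_a: "\<exists>n\<in>plane. b \<otimes> a = a [^] ((1::int) + 3 ^ (r - 2)) \<otimes> n \<otimes> b"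
    and gen: "\<And>x. x \<in> carrier G \<Longrightarrow> \<exists>(i::int) (j::int). \<exists>n\<in>plane. x = a [^] i \<otimes> b [^] j \<otimes> n"
  shows "colourable G"
proof -
  define c where "c = a [^] ((3::int) ^ (r - 2))"
  have c: "c \<in> carrier G" using ab by (simp add: c_def)
  obtain s where s: "r = Suc (Suc (Suc s))" "s \<ge> 1"
  proof (rule that[of "r - 3"])
    show "r = Suc (Suc (Suc (r - 3)))" "r - 3 \<ge> 1" using r by simp_all
  qed
  obtain n0 where n0: "n0 \<in> plane" "b \<otimes> a = a [^] ((1::int) + 3 ^ (r - 2)) \<otimes> n0 \<otimes> b"
    using conj_a by blast
  have n0c: "n0 \<in> carrier G" by (rule plane_closed[OF n0(1)])
  have ba: "b \<otimes> a = a \<otimes> (c \<otimes> n0) \<otimes> b"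
    using n0(2) ab n0c by (simp add: int_pow_mult c_def m_assoc)
  have c_cube: "c = (a [^] ((3::int) ^ s)) [^] (3::int)"
    using ab by (simp add: c_def s int_pow_pow mult.commute)
  have c3: "c [^] (3::int) = a [^] ((3::int) ^ (r - 1))"
    using ab by (simp add: c_def s int_pow_pow mult.commute)
  have c9: "c [^] (9::int) = \<one>"
    using el_cube[OF a_pow] c int_pow_pow[of c 3 3] by (simp add: c3)
  \<comment> \<open>On cubes the plane factor \<open>n0\<close> disappears, so b raises a^3, and
    with it c, to the power 1 + 3^(r-2). As r >= 4, the exponent 3^(r-2) is divisible by 9, and c^9
    = 1.\<close>
  have "b \<otimes> c \<otimes> inv b = c"
  proof -
    let ?q = "(1::int) + 3 ^ (r - 2)"
    have "b \<otimes> a \<otimes> inv b = a [^] ?q \<otimes> n0"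
      using n0(2) ab n0c by (simp add: m_assoc)
    then have "b \<otimes> a [^] (3::int) \<otimes> inv b = (a [^] ?q) [^] (3::int)"
      using conj_int_pow[OF ab(2,1), of 3] cube_mult_plane[OF _ n0(1)] ab by simp
    also have "\<dots> = (a [^] (3::int)) [^] ?q" using ab by (simp add: int_pow_pow mult.commute)
    finally have "b \<otimes> (a [^] (3::int)) [^] ((3::int) ^ s) \<otimes> inv b = ((a [^] (3::int)) [^] ?q) [^] ((3::int) ^ s)"
      using conj_int_pow[OF ab(2), of "a [^] (3::int)" "3 ^ s"] ab by simp
    moreover have "(a [^] (3::int)) [^] ((3::int) ^ s) = c"
      using ab by (simp add: c_def s int_pow_pow)
    moreover have "((a [^] (3::int)) [^] ?q) [^] ((3::int) ^ s) = c [^] ?q"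
      using ab by (simp add: c_def s int_pow_pow algebra_simps)
    moreover have "c [^] ?q = c"
    proof -
      obtain s' where "s = Suc s'" using s(2) by (cases s) auto
      then have "c [^] ((3::int) ^ (r - 2)) = (c [^] (9::int)) [^] ((3::int) ^ s')"
        using c by (simp add: s(1) int_pow_pow)
      then show ?thesis using c c9 by (simp add: int_pow_mult)
    qed
    ultimately show ?thesis by simp
  qed
  then have "b \<otimes> c \<otimes> inv b \<otimes> b = c \<otimes> b" by simp
  then have bc: "b \<otimes> c = c \<otimes> b" using ab c by (simp add: m_assoc)
  have ac: "a \<otimes> c = c \<otimes> a" unfolding c_def using int_pow_commute[of a a] ab by simp
  have nc: "x \<otimes> c = c \<otimes> x" if "x \<in> plane" for x
    unfolding c_cube using cube_commutes[OF _ that] ab by simp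
  have cc: "x \<otimes> c = c \<otimes> x" if x: "x \<in> carrier G" for x
  proof -
    from gen[OF x] obtain i j :: int and m where m: "m \<in> plane" and xe: "x = a [^] i \<otimes> b [^] j \<otimes> m" by blast
    show ?thesis unfolding xe
      using ab c m nc ac bc plane_closed[OF m] by (intro commute_mult int_pow_commute) auto
  qed
  have cck: "x \<otimes> c [^] k = c [^] k \<otimes> x" if "x \<in> carrier G" for x and k :: int
    using int_pow_commute[OF c that, of k] cc[OF that] by simp
  obtain x y where n0e: "n0 = el x y" using n0(1) by (rule planeE)
  obtain pa where pa: "twist a pa" using twist_exists ab by blast
  obtain pb where pb: "twist b pb" using twist_exists ab by blast
  have b_div: "b [^] ((3::int) ^ Suc k) \<in> plane" for k
  proof -
    obtain i j where "b [^] (3::int) = el i j" using b_pow by (rule planeE)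
    then have "b [^] ((3::int) ^ Suc k) = el (i * 3 ^ k) (j * 3 ^ k)"
      using ab int_pow_pow[of b 3 "3 ^ k"] by (simp add: el_pow)
    then show ?thesis by simp
  qed
  show ?thesis
  proof (cases "c [^] (3::int) = \<one>")
    case True
    \<comment> \<open>Chosen so that c n0 = w^x c', which puts the commutator of b and a into the
      new plane <w, c'>; u joins a and b as a generator of the quotient.\<close>
    define c' where "c' = c \<otimes> u [^] y"
    have c': "c' \<in> carrier G" using c by (simp add: c'_def)
    have c'_notin: "c' \<noteq> w [^] k" for k :: int
    proof
      assume "c' = w [^] k"
      then have "c = el k 0 \<otimes> inv (el 0 y)" using c by (simp add: c'_def el_c el_u inv_solve_right)
      then show False using c_notin by (simp add: el_inv el_mult c_def)
    qed
    have c'_tw: "\<exists>k::int. t \<otimes> c' = w [^] k \<otimes> c' \<otimes> t" if t: "t \<in> carrier G" for t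
    proof -
      obtain p where p: "twist t p" using twist_exists[OF t] by blast
      have "t \<otimes> c' = c \<otimes> (t \<otimes> el 0 y)"
        using t c cc[OF t] by (simp add: c'_def el_u flip: m_assoc)
      also have "\<dots> = c \<otimes> w [^] (p * y) \<otimes> u [^] y \<otimes> t"
        using twist_el[OF p t, of 0 y] t c by (simp add: el_def m_assoc)
      also have "c \<otimes> w [^] (p * y) = w [^] (p * y) \<otimes> c" using c by (simp add: cc)
      finally show ?thesis using t c by (auto simp: c'_def m_assoc)
    qed
    have "c' [^] (3::int) = c [^] (3::int) \<otimes> (u [^] y) [^] (3::int)"
      unfolding c'_def using c cc by (intro int_pow_mult_distrib) simp_all
    also have "\<dots> = \<one>" using True el_eq_one_iff[of 0 "y * 3"] by (simp add: int_pow_pow el_u)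
    finally have c'3: "c' [^] (3::int) = \<one>" .
    have "twisted_plane G 3 w c'"
      by (rule twisted_plane_3I[OF is_group _ c' central c_pow c'3 c'_notin c'_tw]) auto
    then interpret V: twisted_plane G 3 w c' .
    have wV: "w [^] j \<in> V.plane" for j :: int using V.el_in_plane[of j 0] by (simp add: V.el_c)
    have one: "\<one> \<in> V.plane" using V.el_in_plane[of 0 0] by (simp add: V.el_0)
    show ?thesis
    proof (rule V.colourable_if_abelian_quotient[OF IH ord, of "r - 1" a b u])
      show "int (order G) = 3 * 3 * 3 ^ Suc (r - 1)" using ord n r by (simp add: power_add)
      show "\<exists>n\<in>V.plane. b \<otimes> a = a \<otimes> n \<otimes> b"
      proof
        have "c \<otimes> n0 = w [^] x \<otimes> c'"
          using c cc[of "w [^] x"] by (simp add: n0e el_def c'_def flip: m_assoc)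
        then show "b \<otimes> a = a \<otimes> V.el x 1 \<otimes> b" using ba c' by (simp add: V.el_def)
      qed simp
      show "\<exists>n\<in>V.plane. u \<otimes> a = a \<otimes> n \<otimes> u"
        using twist_el'[OF pa ab(1), of 0 1] ab wV by (intro bexI[of _ "w [^] (- pa)"]) (simp_all add: el_def m_assoc)
      show "\<exists>n\<in>V.plane. u \<otimes> b = b \<otimes> n \<otimes> u"
        using twist_el'[OF pb ab(2), of 0 1] ab wV by (intro bexI[of _ "w [^] (- pb)"]) (simp_all add: el_def m_assoc)
      show "a [^] ((3::int) ^ (r - 1)) \<in> V.plane" using one True c3 by simp
      have "u [^] ((3::int) ^ (r - 1)) = \<one>"
        using el_eq_one_iff[of 0 "3 ^ (r - 1)"] by (simp add: el_u s)
      then show "u [^] ((3::int) ^ (r - 1)) \<in> V.plane" using one by simp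
      have "b [^] ((3::int) ^ (r - 1)) = (b [^] ((3::int) ^ Suc s)) [^] (3::int)"
        using ab by (simp add: s int_pow_pow mult.commute)
      then have "b [^] ((3::int) ^ (r - 1)) = \<one>" using el_cube[OF b_div] by simp
      then show "b [^] ((3::int) ^ (r - 1)) \<in> V.plane" using one by simp
      fix x assume "x \<in> carrier G"
      then obtain i j :: int and m where "m \<in> plane" "x = a [^] i \<otimes> b [^] j \<otimes> m" using gen by blast
      moreover from this obtain z l where "m = el z l" by (auto elim: planeE)
      ultimately have "x = a [^] i \<otimes> b [^] j \<otimes> u [^] l \<otimes> w [^] z"
        using ab c_commute[of "u [^] l" z] by (simp add: el_def m_assoc)
      then show "\<exists>(i::int) (j::int) (l::int). \<exists>n\<in>V.plane. x = a [^] i \<otimes> b [^] j \<otimes> u [^] l \<otimes> n"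
        using wV by blast
    qed (use ab in auto)
  next
    case False
    \<comment> \<open>Cubing a^-1 b a = c b n, with n in the plane, gives a^-1 b^3 a = c^3 b^3.
      Hence c^3 is a commutator of a with the plane element b^3, that is, a power of w.\<close>
    obtain k :: int where c3w: "c [^] (3::int) = w [^] k"
    proof -
      obtain i j where b3: "b [^] (3::int) = el i j" using b_pow by (rule planeE)
      have "b \<otimes> a = a \<otimes> c \<otimes> (n0 \<otimes> b)" using ba ab c n0c by (simp add: m_assoc)
      then have "inv a \<otimes> b \<otimes> a = inv a \<otimes> (a \<otimes> c \<otimes> (n0 \<otimes> b))" using ab by (simp add: m_assoc)
      also have "\<dots> = c \<otimes> (n0 \<otimes> b)" using ab c n0c by (simp flip: m_assoc)
      also have "n0 \<otimes> b = b \<otimes> (inv b \<otimes> n0 \<otimes> b)" using ab n0c by (simp flip: m_assoc)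
      finally have e: "inv a \<otimes> b \<otimes> a = c \<otimes> (b \<otimes> (inv b \<otimes> n0 \<otimes> b))" .
      have np: "inv b \<otimes> n0 \<otimes> b \<in> plane" using normal.inv_op_closed1[OF normal_plane ab(2) n0(1)] .
      have "(inv a \<otimes> b \<otimes> a) [^] (3::int) = inv a \<otimes> b [^] (3::int) \<otimes> a"
        using conj_int_pow[of "inv a" b 3] ab by simp
      moreover have "(c \<otimes> (b \<otimes> (inv b \<otimes> n0 \<otimes> b))) [^] (3::int) = c [^] (3::int) \<otimes> b [^] (3::int)"
        using c ab n0c cube_mult_plane[OF ab(2) np] cc
        by (subst int_pow_mult_distrib) simp_all
      ultimately have "inv a \<otimes> el i j \<otimes> a = c [^] (3::int) \<otimes> el i j" using e b3 by simp
      moreover have "inv a \<otimes> el i j \<otimes> a = el (i - pa * j) j"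
        using ab twist_el'[OF pa ab(1), of i j] by (simp add: m_assoc) (simp flip: m_assoc)
      ultimately have "c [^] (3::int) = el (i - pa * j) j \<otimes> inv (el i j)"
        using c by (simp add: inv_solve_right)
      also have "\<dots> = w [^] (- (pa * j))" by (simp add: el_inv el_mult el_c)
      finally show ?thesis using that by blast
    qed
    have k: "\<not> 3 dvd k" using False c3w c_pow by simp
    have "Factorial_Ring.prime (3::int)" by simp
    then have dvd3: "3 dvd a * b \<longleftrightarrow> 3 dvd a \<or> 3 dvd b" for a b :: int by (rule prime_dvd_mult_iff)
    have c3l: "c [^] (3 * l) = w [^] (k * l)" for l
      using c int_pow_pow[of c 3 l] by (simp add: c3w int_pow_pow)
    have c_imp: "3 dvd l" if "(c [^] l) [^] (3::int) = \<one>" for l :: int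
    proof -
      have "w [^] (k * l) = \<one>" using that c c3l[of l] by (simp add: int_pow_pow mult.commute)
      then show ?thesis using k dvd3 c_pow by simp
    qed
    \<comment> \<open>As c^3 = w^k with k prime to 3, c has order 9 and its subgroup of order 3 is
      <w>. A twist w^p of u equals c^(3kp) because k*k is 1 modulo 3.\<close>
    have twisted: "twisted_plane G 9 c u"
    proof (unfold_locales)
      show "c [^] l = \<one> \<longleftrightarrow> 9 dvd l" for l :: int
      proof
        assume l: "c [^] l = \<one>"
        then have "3 dvd l" by (intro c_imp) simp
        then obtain l' where l': "l = 3 * l'" by blast
        then have "w [^] (k * l') = \<one>" using l c3l by simp
        then have "3 dvd l'" using k dvd3 c_pow by simp
        then show "9 dvd l" unfolding l' by auto
      next
        assume "9 dvd l"
        then obtain l' where "l = 9 * l'" by blast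
        then show "c [^] l = \<one>" using int_pow_pow[OF c, of 9 l'] c9 by simp
      qed
      show "u \<noteq> c [^] l" for l :: int
      proof
        assume l: "u = c [^] l"
        then have "3 dvd l" using u3 by (intro c_imp) simp
        then obtain l' where l': "l = 3 * l'" by blast
        then show False using l c3l u_notin by simp
      qed
      show "\<exists>p. t \<otimes> u = c [^] ((9::int) div 3 * p) \<otimes> u \<otimes> t" if t: "t \<in> carrier G" for t
      proof -
        obtain p :: int where p: "t \<otimes> u = w [^] p \<otimes> u \<otimes> t" using conj[OF t] by auto
        have "k * (k * p) - p = (k * k - 1) * p" by (simp add: algebra_simps)
        then have "3 dvd k * (k * p) - p" using square_mod_3[OF k] by simp
        then have "w [^] (k * (k * p)) = w [^] p" unfolding el_c[symmetric] el_eq_iff by simp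
        then have "c [^] ((9::int) div 3 * (k * p)) = w [^] p" using c3l[of "k * p"] by simp
        then show ?thesis using p by metis
      qed
    qed (use c cc u3 in auto)
    interpret V: twisted_plane G 9 c u by (rule twisted)
    have one: "\<one> \<in> V.plane" using V.el_in_plane[of 0 0] by (simp add: V.el_0)
    have wV: "w [^] l \<in> V.plane" for l :: int
    proof -
      have "k * (k * l) - l = (k * k - 1) * l" by (simp add: algebra_simps)
      then have "3 dvd k * (k * l) - l" using square_mod_3[OF k] by simp
      then have "w [^] l = w [^] (k * (k * l))"
        unfolding el_c[symmetric] el_eq_iff by (simp add: dvd_diff_commute)
      also have "\<dots> = V.el (3 * (k * l)) 0" using c3l by (simp add: V.el_c)
      finally show ?thesis by simp
    qed
    interpret V': subgroup V.plane G by (rule V.subgroup_plane)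
    have sub: "m \<in> V.plane" if m: "m \<in> plane" for m
    proof -
      obtain z l where "m = el z l" using m by (rule planeE)
      moreover have "u [^] l \<in> V.plane" using V.el_in_plane[of 0 l] by (simp add: V.el_u)
      ultimately show ?thesis using wV by (simp add: el_def)
    qed
    show ?thesis
    proof (rule V.colourable_if_abelian_quotient[OF IH ord, of "r - 2" a b \<one>])
      \<comment> \<open>Here the quotient has order 3^(r-1), and a^(3^(r-2)) = c lies in the plane,
        so the exponent is again one factor of 3 short.\<close>
      show "int (order G) = 3 * 9 * 3 ^ Suc (r - 2)" using ord by (simp add: n s(1))
      have cV: "c \<in> V.plane" using V.el_in_plane[of 1 0] c by (simp add: V.el_c)
      show "\<exists>n\<in>V.plane. b \<otimes> a = a \<otimes> n \<otimes> b" using ba cV sub[OF n0(1)] by blast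
      show "\<exists>n\<in>V.plane. \<one> \<otimes> a = a \<otimes> n \<otimes> \<one>" "\<exists>n\<in>V.plane. \<one> \<otimes> b = b \<otimes> n \<otimes> \<one>"
        using one ab by (auto intro!: bexI[of _ \<one>])
      show "a [^] ((3::int) ^ (r - 2)) \<in> V.plane" using cV by (simp add: c_def)
      show "b [^] ((3::int) ^ (r - 2)) \<in> V.plane" using sub[OF b_div[of s]] by (simp add: s(1))
      show "\<one> [^] ((3::int) ^ (r - 2)) \<in> V.plane" using one by simp
      fix x assume "x \<in> carrier G"
      then obtain i j :: int and m where "m \<in> plane" "x = a [^] i \<otimes> b [^] j \<otimes> m" using gen by blast
      then have "x = a [^] i \<otimes> b [^] j \<otimes> \<one> [^] (0::int) \<otimes> m" "m \<in> V.plane"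
        using ab sub by simp_all
      then show "\<exists>(i::int) (j::int) (l::int). \<exists>n\<in>V.plane. x = a [^] i \<otimes> b [^] j \<otimes> \<one> [^] l \<otimes> n"
        by blast
    qed (use ab in auto)
  qed
qed

end

section \<open>The case distinction on the quotient and the induction\<close>

lemma colourable_step:
  fixes G (structure)
  assumes G: "group G" and ord: "order G = 3 ^ n" and noncyc: "\<not> cyclic_group G"
    and nonmod: "\<And>r. r \<ge> 4 \<Longrightarrow> \<not> modular_type G r" and IH: "smaller_colourable n"
  shows "colourable G"
proof -
  interpret group G by fact
  have "card (carrier G) > 0" using ord by (simp add: order_def)
  then have fin: "finite (carrier G)" by (rule card_ge_0_finite)
  obtain w u where tp: "twisted_plane G 3 w u" using twisted_plane_exists[OF G ord noncyc] by blast
  then interpret order_3_plane G w u by (rule order_3_plane.intro)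
  obtain H :: "nat monoid" and \<pi> where H: "group H" "group_hom G H \<pi>" "\<pi> ` carrier G = carrier H"
    "kernel G H \<pi> = plane" "order G = card plane * order H"
    using quotient_on_nat[OF normal_plane fin] by blast
  interpret \<pi>: group_hom G H \<pi> by fact
  have "order H dvd 3 ^ n" using H(5) ord by (metis dvd_triv_right)
  then obtain k where k: "order H = 3 ^ k" using divides_primepow_nat[of 3] by auto
  have "card plane = 9" using card_plane by simp
  then have "(3::nat) ^ n = 3 ^ (k + 2)" using ord k H(5) by (simp add: power_add)
  then have n: "n = k + 2" by (simp only: power_inject_exp one_less_numeral_iff semiring_norm)
  have ker: "\<pi> x = \<one>\<^bsub>H\<^esub> \<longleftrightarrow> x \<in> plane" if "x \<in> carrier G" for x
    unfolding H(4)[symmetric] using that by (simp add: kernel_def)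
  have lift: "\<exists>x\<in>carrier G. \<pi> x = y" if "y \<in> carrier H" for y
    using that unfolding H(3)[symmetric] by (metis imageE)
  consider "carrier H = {\<one>\<^bsub>H\<^esub>}" | "carrier H \<noteq> {\<one>\<^bsub>H\<^esub>}" "cyclic_group H"
    | r where "r \<ge> 4" "modular_type H r" | "\<not> cyclic_group H" "\<forall>r\<ge>4. \<not> modular_type H r"
    by blast
  then show ?thesis
  proof cases
    case 1
    then show ?thesis using colourable_if_quotient[OF fin H(2-4)] \<pi>.H.colourable_if_trivial by blast
  next
    case 2
    obtain y where y: "y \<in> carrier H" "\<And>x. x \<in> carrier H \<Longrightarrow> \<exists>k::int. x = y [^]\<^bsub>H\<^esub> k"
      using \<pi>.H.cyclic_groupE[OF 2(2)] by blast
    obtain g where g: "g \<in> carrier G" "\<pi> g = y" using lift[OF y(1)] by blast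
    have "k \<noteq> 0"
    proof
      assume "k = 0"
      then have "carrier H = {\<one>\<^bsub>H\<^esub>}" using k by (metis \<pi>.H.order_one_triv_iff power_0)
      then show False using 2 by simp
    qed
    then obtain k' where k': "k = Suc k'" by (cases k) auto
    have "y [^]\<^bsub>H\<^esub> order H = \<one>\<^bsub>H\<^esub>" using \<pi>.H.pow_order_eq_1 y by blast
    then have "y [^]\<^bsub>H\<^esub> ((3::int) ^ Suc k') = \<one>\<^bsub>H\<^esub>"
      using k k' by (metis int_pow_int of_nat_numeral of_nat_power)
    then have 1: "g [^] ((3::int) ^ Suc k') \<in> plane"
      using ker[of "g [^] ((3::int) ^ Suc k')"] g by (simp add: \<pi>.hom_int_pow)
    have 2: "g [^] ((3::int) ^ k') \<notin> plane"
    proof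
      assume "g [^] ((3::int) ^ k') \<in> plane"
      then have "y [^]\<^bsub>H\<^esub> ((3::int) ^ k') = \<one>\<^bsub>H\<^esub>"
        using ker[of "g [^] ((3::int) ^ k')"] g by (simp add: \<pi>.hom_int_pow)
      from \<pi>.H.order_le_of_generator[OF y this] show False using k k' by simp
    qed
    show ?thesis
    proof (rule colourable_if_cyclic_quotient[OF IH ord _ nonmod g(1) 1 2])
      show "n = Suc (Suc (Suc k'))" using n k' by simp
      fix x assume x: "x \<in> carrier G"
      then obtain j :: int where j: "\<pi> x = y [^]\<^bsub>H\<^esub> j" using y(2)[OF \<pi>.hom_closed[OF x]] by blast
      have "\<pi> (x \<otimes> inv (g [^] j)) = \<one>\<^bsub>H\<^esub>" using x g y j by (simp add: \<pi>.hom_int_pow)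
      then have "x \<otimes> inv (g [^] j) \<in> plane"
        using ker[of "x \<otimes> inv (g [^] j)"] x g(1) by simp
      moreover have "x = x \<otimes> inv (g [^] j) \<otimes> g [^] j" using x g by (simp add: m_assoc)
      ultimately show "\<exists>n\<in>plane. \<exists>j::int. x = n \<otimes> g [^] j" by blast
    qed
  next
    case (3 r)
    then obtain \<alpha> \<beta> where \<alpha>\<beta>: "\<alpha> \<in> carrier H" "\<beta> \<in> carrier H"
      and rels: "\<alpha> [^]\<^bsub>H\<^esub> ((3::int) ^ (r - 1)) = \<one>\<^bsub>H\<^esub>" "\<beta> [^]\<^bsub>H\<^esub> (3::int) = \<one>\<^bsub>H\<^esub>"
        "\<beta> \<otimes>\<^bsub>H\<^esub> \<alpha> \<otimes>\<^bsub>H\<^esub> inv\<^bsub>H\<^esub> \<beta> = \<alpha> [^]\<^bsub>H\<^esub> ((1::int) + 3 ^ (r - 2))"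
      and gen: "\<And>x. x \<in> carrier H \<Longrightarrow> \<exists>(i::int) (j::int). x = \<alpha> [^]\<^bsub>H\<^esub> i \<otimes>\<^bsub>H\<^esub> \<beta> [^]\<^bsub>H\<^esub> j"
      and ordH: "order H = 3 ^ r"
      unfolding modular_type_def by blast
    obtain a b where ab: "a \<in> carrier G" "\<pi> a = \<alpha>" "b \<in> carrier G" "\<pi> b = \<beta>"
      using lift \<alpha>\<beta> by meson
    have "k = r" using k ordH by simp
    show ?thesis
    proof (rule colourable_if_modular_quotient[OF IH ord _ 3(1) ab(1,3)])
      show "n = r + 2" using n \<open>k = r\<close> by simp
      show "a [^] ((3::int) ^ (r - 1)) \<in> plane"
        using ker[of "a [^] ((3::int) ^ (r - 1))"] ab rels(1) by (simp add: \<pi>.hom_int_pow)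
      show "b [^] (3::int) \<in> plane"
        using ker[of "b [^] (3::int)"] ab rels(2) by (simp add: \<pi>.hom_int_pow)
      \<comment> \<open>Otherwise the first generator of the quotient would satisfy a shorter
        relation, and the normal form would give at most 3^(r-1) elements.\<close>
      show "a [^] ((3::int) ^ (r - 2)) \<notin> plane"
      proof
        assume "a [^] ((3::int) ^ (r - 2)) \<in> plane"
        then have "\<alpha> [^]\<^bsub>H\<^esub> ((3::int) ^ (r - 2)) = \<one>\<^bsub>H\<^esub>"
          using ker[of "a [^] ((3::int) ^ (r - 2))"] ab by (simp add: \<pi>.hom_int_pow)
        then have "int (order H) \<le> 3 ^ (r - 2) * 3"
          using \<pi>.H.order_le_of_two_generators[OF \<alpha>\<beta> _ rels(2) _ _ gen] by simp
        moreover obtain s where "r = Suc (Suc s)" using 3(1)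
          by (intro that[of "r - 2"]) simp
        ultimately show False using ordH by simp
      qed
      let ?q = "(1::int) + 3 ^ (r - 2)"
      have q: "\<pi> (a [^] ?q) = \<alpha> [^]\<^bsub>H\<^esub> ?q" using ab by (simp only: \<pi>.hom_int_pow)
      have "\<pi> (inv (a [^] ?q) \<otimes> (b \<otimes> a \<otimes> inv b)) = \<one>\<^bsub>H\<^esub>"
        using ab \<alpha>\<beta> q rels(3) by simp
      then have "inv (a [^] ?q) \<otimes> (b \<otimes> a \<otimes> inv b) \<in> plane"
        by (subst ker[symmetric]) (use ab in simp_all)
      moreover have "b \<otimes> a = a [^] ?q \<otimes> (inv (a [^] ?q) \<otimes> (b \<otimes> a \<otimes> inv b)) \<otimes> b"
      proof -
        have "a [^] ?q \<otimes> (inv (a [^] ?q) \<otimes> (b \<otimes> a \<otimes> inv b)) = b \<otimes> a \<otimes> inv b"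
          using ab by (subst m_assoc[symmetric]) simp_all
        then show ?thesis using ab by (simp add: m_assoc)
      qed
      ultimately show "\<exists>n\<in>plane. b \<otimes> a = a [^] ?q \<otimes> n \<otimes> b" by blast
      fix x assume x: "x \<in> carrier G"
      from gen[OF \<pi>.hom_closed[OF x]] obtain i j :: int
        where ij: "\<pi> x = \<alpha> [^]\<^bsub>H\<^esub> i \<otimes>\<^bsub>H\<^esub> \<beta> [^]\<^bsub>H\<^esub> j" by blast
      let ?y = "a [^] i \<otimes> b [^] j"
      have "\<pi> ?y = \<pi> x" using ab ij by (simp add: \<pi>.hom_int_pow)
      then have "\<pi> (inv ?y \<otimes> x) = \<one>\<^bsub>H\<^esub>" using ab x by (simp del: inv_mult_group)
      then have "inv ?y \<otimes> x \<in> plane"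
        by (subst ker[symmetric]) (use ab x in \<open>simp_all del: inv_mult_group\<close>)
      moreover have "x = ?y \<otimes> (inv ?y \<otimes> x)"
        using ab x by (subst m_assoc[symmetric]) simp_all
      ultimately show "\<exists>(i::int) (j::int). \<exists>n\<in>plane. x = a [^] i \<otimes> b [^] j \<otimes> n" by blast
    qed
  next
    case 4
    moreover have "k < n" using n by simp
    ultimately have "colourable H" using IH H(1) k unfolding smaller_colourable_def by blast
    then show ?thesis by (rule colourable_if_quotient[OF fin H(2-4)])
  qed
qed

lemma smaller_colourable_all: "smaller_colourable n"
proof (induction n)
  case (Suc n)
  show ?case
    unfolding smaller_colourable_def
  proof (intro allI impI)
    fix k and H :: "nat monoid"
    assume k: "k < Suc n" and H: "group H" "order H = 3 ^ k" "\<not> cyclic_group H"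
      "\<forall>r\<ge>4. \<not> modular_type H r"
    have "j < n" if "j < k" for j using that k by simp
    then have "smaller_colourable k" using Suc unfolding smaller_colourable_def by blast
    then show "colourable H" using colourable_step[OF H(1-3)] H(4) by blast
  qed
qed (simp add: smaller_colourable_def)

theorem theorem4p3:
  fixes G :: "'a monoid"
  assumes "group G"
    and "finite (carrier G)"
    and "\<exists>n. order G = 3 ^ n"
    and "\<not> cyclic_group G"
    and "\<And>r. r \<ge> 4 \<Longrightarrow> \<not> G \<cong> L r"
  shows "colourable G"
proof -
  obtain n where "order G = 3 ^ n" using assms(3) by blast
  moreover have "\<not> modular_type G r" if "r \<ge> 4" for r
    using modular_type_imp_iso_L[OF assms(1), of r] assms(5)[OF that] that by auto
  ultimately show ?thesis
    using colourable_step[OF assms(1) _ assms(4) _ smaller_colourable_all] by blast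
qed

end
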